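(* For every $R \geq 0$ there exists $N \geq 0$ such that both of the following hold. (1) $\mathrm{rad}\big(\Sigma^{\mathsf{Br}}_{i_1} \cdots \Sigma^{\mathsf{Br}}_{i_n}(V)\big) \geq R$ for every finite sequence $(i_1, \ldots, i_n) \in \{1,2,3\}^n$ containing more than $N$ occurrences of $3$, and for every $V \in \{V^{\mathsf{Br}}_1, V^{\mathsf{Br}}_2\}$. (2) $\mathrm{rad}\big(\Sigma^{\mathsf{JP}}_{a_1,b_1} \cdots \Sigma^{\mathsf{JP}}_{a_n,b_n}(V)\big) \geq R$ for every admissible Jacobi-Perron expansion $(a_1,b_1), \ldots, (a_n,b_n)$ with $n \geq N$, and for every $V \in \{V^{\mathsf{JP}}_1, V^{\mathsf{JP}}_2, V^{\mathsf{JP}}_3, V^{\mathsf{JP}}_4\}$.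
   Context: Faces and patterns. Let $(\mathbf e_1,\mathbf e_2,\mathbf e_3)$ be the canonical basis of $\mathbb R^3$. For $\mathbf x\in\mathbb Z^3$ and $i\in\{1,2,3\}$, the face $[\mathbf x,i]^\star$ is the unit square $\{\mathbf x+\lambda\mathbf e_j+\mu\mathbf e_k:\lambda,\mu\in[0,1]\}$ where $\{i,j,k\}=\{1,2,3\}$; $i$ is its type and $\mathbf x$ its vector. A pattern is a finite union of faces (identified with the set of its faces). Write $\mathbf y+[\mathbf x,i]^\star=[\mathbf x+\mathbf y,i]^\star$. Let $U=[\mathbf 0,1]^\star\cup[\mathbf 0,2]^\star\cup[\mathbf 0,3]^\star$. The boundary of a pattern $P$ is the union of the edges of faces of $P$ that are contained in exactly one face of $P$. For a pattern $P\supseteq U$, the minimal combinatorial radius $\mathrm{rad}(P)$ is the length $m$ of a shortest sequence of faces $f_1,\dots,f_m$ of $P$ such that $f_1\in U$, $f_k$ and $f_{k+1}$ share an edge for each $k$, and $f_m$ shares an edge with the boundary of $P$. Dual substitutions. For a substitution $\sigma$ on $\{1,2,3\}$ (a non-erasing morphism of the free monoid), let $\mathbf P(w)=(|w|_1,|w|_2,|w|_3)$ be the abelianization of a word $w$, and let $\mathbf M_\sigma$ be the matrix whose $i$th column is $\mathbf P(\sigma(i))$. If $\det\mathbf M_\sigma=\pm1$, the dual substitution is $$\mathbf E_1^\star(\sigma)([\mathbf x,i]^\star)=\bigcup_{(p,j,s):\ \sigma(j)=pis}[\mathbf M_\sigma^{-1}(\mathbf x+\mathbf P(s)),j]^\star,$$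 extended to unions of faces by taking unions. Products of dual substitutions denote compositions of maps. Brun substitutions: $\sigma^{\mathsf{Br}}_1:1\mapsto1,2\mapsto2,3\mapsto32$; $\sigma^{\mathsf{Br}}_2:1\mapsto1,2\mapsto3,3\mapsto23$; $\sigma^{\mathsf{Br}}_3:1\mapsto2,2\mapsto3,3\mapsto13$; and $\Sigma^{\mathsf{Br}}_i=\mathbf E_1^\star(\sigma^{\mathsf{Br}}_i)$. Jacobi-Perron substitutions: $\sigma^{\mathsf{JP}}_{a,b}:1\mapsto3,2\mapsto13^a,3\mapsto23^b$ for integers $a,b\ge0$; and $\Sigma^{\mathsf{JP}}_{a,b}=\mathbf E_1^\star(\sigma^{\mathsf{JP}}_{a,b})$. A finite sequence $(a_1,b_1),\dots,(a_n,b_n)$ of pairs of integers is an admissible Jacobi-Perron expansion if $0\le a_k\le b_k$ and $b_k\ne0$ for all $k\in\{1,\dots,n\}$, and $a_k=b_k$ implies $a_{k+1}\neq0$ for all $k\in\{1,\dots,n-1\}$. Seeds. Let $C=\{[(1,0,0),2]^\star,[(1,0,0),3]^\star,[(-1,1,0),2]^\star,[(-1,1,0),3]^\star,[(0,1,0),3]^\star,[(-1,0,1),3]^\star,[(0,-1,1),3]^\star,[(1,-1,1),3]^\star\}$, $C'=\{[(0,1,0),1]^\star,[(0,1,0),3]^\star,[(1,-1,0),1]^\star,[(1,-1,0),3]^\star,[(1,0,0),3]^\star,[(0,-1,1),3]^\star,[(-1,0,1),3]^\star,[(-1,1,1),3]^\star\}$, $D=\{[(-1,-1,1),3]^\star,[(1,1,0),3]^\star\}$,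 $E=\{[(0,-1,1),1]^\star,[(-1,0,1),2]^\star,[(1,1,-1),1]^\star,[(1,1,-1),2]^\star,[(1,1,-1),3]^\star\}$. Then $V^{\mathsf{Br}}_1=U\cup C\cup D$ and $V^{\mathsf{Br}}_2=U\cup C\cup E\cup[(0,-1,1),2]^\star$. The four Jacobi-Perron seeds $V^{\mathsf{JP}}_1,\dots,V^{\mathsf{JP}}_4$ are $U\cup C\cup D$, $U\cup C\cup E$, $U\cup C'\cup D$ and $U\cup C'\cup E$. *)

theory Defs
  imports "HOL-Analysis.Analysis"
begin

section \<open>Faces and patterns\<close>

text \<open>
  The three letters, the three coordinates and the three face types are the elements
  of the type \<^typ>\<open>3\<close>; its numerals \<open>1\<close>, \<open>2\<close>, \<open>3\<close> are its three distinct elements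
  (and \<open>0 = 3\<close> there).
  A face is represented by the pair of its vector and its type, and a pattern, being
  identified with the set of its faces, by a finite set of such pairs.
\<close>

type_synonym face = "(int ^ 3) \<times> 3"
type_synonym pattern = "face set"

definition point :: "int ^ 3 \<Rightarrow> real ^ 3" where
  "point x = (\<chi> k. real_of_int (x $ k))"

definition square :: "face \<Rightarrow> (real ^ 3) set" where
  "square = (\<lambda>(x, i). {point x + l *\<^sub>R axis j 1 + m *\<^sub>R axis k 1 | l m j k.
     {i, j, k} = UNIV \<and> 0 \<le> l \<and> l \<le> 1 \<and> 0 \<le> m \<and> m \<le> 1})"

text \<open>
  The four sides of the square: for either of the two directions \<open>k \<noteq> i\<close>, one side in
  direction \<open>k\<close> starts at \<open>x\<close> and one at \<open>x\<close> shifted by the other basis vector.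
\<close>

definition edges :: "face \<Rightarrow> (real ^ 3) set set" where
  "edges = (\<lambda>(x, i). {closed_segment (point y) (point (y + axis k 1)) | y j k.
     {i, j, k} = UNIV \<and> y \<in> {x, x + axis j 1}})"

definition share_edge :: "face \<Rightarrow> face \<Rightarrow> bool" where
  "share_edge f g \<longleftrightarrow> (\<exists>e. e \<in> edges f \<and> e \<in> edges g)"

definition boundary :: "pattern \<Rightarrow> (real ^ 3) set" where
  "boundary P = \<Union>{e. (\<exists>f\<in>P. e \<in> edges f) \<and> (\<exists>!g. g \<in> P \<and> e \<subseteq> square g)}"

definition unit_pattern :: pattern where
  "unit_pattern = {(0, 1), (0, 2), (0, 3)}"

text \<open>
  The infimum over the natural numbers is attained when the set is nonempty, and it is
  \<open>0\<close> for the empty set. Hence a lower bound \<open>R > 0\<close> on the radius includes the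
  existence of a path from the unit pattern to the boundary.
\<close>

definition rad :: "pattern \<Rightarrow> nat" where
  "rad P = Inf {length fs | fs. fs \<noteq> [] \<and> set fs \<subseteq> P \<and> hd fs \<in> unit_pattern \<and>
     successively share_edge fs \<and> (\<exists>e \<in> edges (last fs). e \<subseteq> boundary P)}"


section \<open>Dual substitutions\<close>

text \<open>A substitution is given by the images of the three letters.\<close>

type_synonym subst = "3 \<Rightarrow> 3 list"

definition abelianization :: "3 list \<Rightarrow> int ^ 3" where
  "abelianization w = (\<chi> k. int (count_list w k))"

definition incidence_matrix :: "subst \<Rightarrow> int ^ 3 ^ 3" where
  "incidence_matrix \<sigma> = (\<chi> r c. abelianization (\<sigma> c) $ r)"

text \<open>
  The inverse is taken over the integers, so this definition is meaningful for
  determinant \<open>1\<close> or \<open>-1\<close>.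
\<close>

definition dual_face :: "subst \<Rightarrow> face \<Rightarrow> pattern" where
  "dual_face \<sigma> = (\<lambda>(x, i).
     {(matrix_inv (incidence_matrix \<sigma>) *v (x + abelianization s), j) | p j s.
        \<sigma> j = p @ i # s})"

definition dual_subst :: "subst \<Rightarrow> pattern \<Rightarrow> pattern" where
  "dual_subst \<sigma> P = (\<Union>f\<in>P. dual_face \<sigma> f)"

definition mk_subst :: "3 list \<Rightarrow> 3 list \<Rightarrow> 3 list \<Rightarrow> subst" where
  "mk_subst u v w = (\<lambda>i. if i = 1 then u else if i = 2 then v else w)"

definition subst_Br :: "3 \<Rightarrow> subst" where
  "subst_Br i = (if i = 1 then mk_subst [1] [2] [3, 2]
                 else if i = 2 then mk_subst [1] [3] [2, 3]
                 else mk_subst [2] [3] [1, 3])"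

definition Sigma_Br :: "3 \<Rightarrow> pattern \<Rightarrow> pattern" where
  "Sigma_Br i = dual_subst (subst_Br i)"

definition subst_JP :: "nat \<Rightarrow> nat \<Rightarrow> subst" where
  "subst_JP a b = mk_subst [3] (1 # replicate a 3) (2 # replicate b 3)"

definition Sigma_JP :: "nat \<Rightarrow> nat \<Rightarrow> pattern \<Rightarrow> pattern" where
  "Sigma_JP a b = dual_subst (subst_JP a b)"

definition admissible_JP :: "(nat \<times> nat) list \<Rightarrow> bool" where
  "admissible_JP ab \<longleftrightarrow>
     (\<forall>(a, b) \<in> set ab. a \<le> b \<and> b \<noteq> 0) \<and>
     (\<forall>k. k + 1 < length ab \<longrightarrow> fst (ab ! k) = snd (ab ! k) \<longrightarrow> fst (ab ! (k + 1)) \<noteq> 0)"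


section \<open>Seeds\<close>

definition seed_C :: pattern where
  "seed_C = {(vector [1, 0, 0], 2), (vector [1, 0, 0], 3), (vector [-1, 1, 0], 2),
     (vector [-1, 1, 0], 3), (vector [0, 1, 0], 3), (vector [-1, 0, 1], 3),
     (vector [0, -1, 1], 3), (vector [1, -1, 1], 3)}"

definition seed_C' :: pattern where
  "seed_C' = {(vector [0, 1, 0], 1), (vector [0, 1, 0], 3), (vector [1, -1, 0], 1),
     (vector [1, -1, 0], 3), (vector [1, 0, 0], 3), (vector [0, -1, 1], 3),
     (vector [-1, 0, 1], 3), (vector [-1, 1, 1], 3)}"

definition seed_D :: pattern where
  "seed_D = {(vector [-1, -1, 1], 3), (vector [1, 1, 0], 3)}"

definition seed_E :: pattern where
  "seed_E = {(vector [0, -1, 1], 1), (vector [-1, 0, 1], 2), (vector [1, 1, -1], 1),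
     (vector [1, 1, -1], 2), (vector [1, 1, -1], 3)}"

definition V1_Br :: pattern where
  "V1_Br = unit_pattern \<union> seed_C \<union> seed_D"

definition V2_Br :: pattern where
  "V2_Br = unit_pattern \<union> seed_C \<union> seed_E \<union> {(vector [0, -1, 1], 2)}"

definition V1_JP :: pattern where
  "V1_JP = unit_pattern \<union> seed_C \<union> seed_D"

definition V2_JP :: pattern where
  "V2_JP = unit_pattern \<union> seed_C \<union> seed_E"

definition V3_JP :: pattern where
  "V3_JP = unit_pattern \<union> seed_C' \<union> seed_D"

definition V4_JP :: pattern where
  "V4_JP = unit_pattern \<union> seed_C' \<union> seed_E"


section \<open>Well-definedness\<close>

lemma det_incidence_Br: "\<bar>det (incidence_matrix (subst_Br i))\<bar> = 1"
  using exhaust_3[of i]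
  by (auto simp: det_3 incidence_matrix_def abelianization_def subst_Br_def mk_subst_def)

lemma count_list_replicate: "count_list (replicate n x) y = (if x = y then n else 0)"
  by (induction n) auto

lemma det_incidence_JP: "\<bar>det (incidence_matrix (subst_JP a b))\<bar> = 1"
  by (auto simp: det_3 incidence_matrix_def abelianization_def subst_JP_def mk_subst_def
      count_list_replicate)

text \<open>Dual substitutions map patterns containing the unit pattern to such patterns.\<close>

lemma unit_pattern_subset_dual_subst:
  assumes "\<And>j. \<sigma> j \<noteq> []" and U: "unit_pattern \<subseteq> P"
  shows "unit_pattern \<subseteq> dual_subst \<sigma> P"
proof
  fix f assume "f \<in> unit_pattern"
  then obtain j where f: "f = (0, j)"
    by (auto simp: unit_pattern_def)
  define i where "i = last (\<sigma> j)"
  have \<sigma>: "\<sigma> j = butlast (\<sigma> j) @ i # []"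
    using assms(1) by (simp add: i_def)
  have "abelianization [] = 0"
    by (simp add: abelianization_def vec_eq_iff)
  then have "matrix_inv (incidence_matrix \<sigma>) *v (0 + abelianization []) = 0"
    by (simp add: matrix_vector_mult_def vec_eq_iff)
  then have "f \<in> dual_face \<sigma> (0, i)"
    using \<sigma> f unfolding dual_face_def by force
  moreover have "(0, i) \<in> P"
    using U exhaust_3[of i] by (auto simp: unit_pattern_def)
  ultimately show "f \<in> dual_subst \<sigma> P"
    by (auto simp: dual_subst_def)
qed

lemma finite_dual_subst:
  assumes "finite P"
  shows "finite (dual_subst \<sigma> P)"
proof -
  have "finite (dual_face \<sigma> (x, i))" for x i
  proof -
    have "dual_face \<sigma> (x, i) \<subseteq> (\<Union>j. (\<lambda>n. (matrix_inv (incidence_matrix \<sigma>) *v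
            (x + abelianization (drop n (\<sigma> j))), j)) ` {..length (\<sigma> j)})"
    proof
      fix f assume "f \<in> dual_face \<sigma> (x, i)"
      then obtain p j s where "\<sigma> j = p @ i # s"
        and f: "f = (matrix_inv (incidence_matrix \<sigma>) *v (x + abelianization s), j)"
        by (auto simp: dual_face_def)
      then have "s = drop (length p + 1) (\<sigma> j)" "length p + 1 \<le> length (\<sigma> j)"
        by auto
      then show "f \<in> (\<Union>j. (\<lambda>n. (matrix_inv (incidence_matrix \<sigma>) *v
            (x + abelianization (drop n (\<sigma> j))), j)) ` {..length (\<sigma> j)})"
        using f by blast
    qed
    then show ?thesis
      by (rule finite_subset) auto
  qed
  then show ?thesis
    using assms by (auto simp: dual_subst_def)
qed

end

theory Submission
  imports Defs
begin

text \<open>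
  For positive integer weights \<open>v\<close>, let \<open>plane v\<close> be the discrete plane of the faces
  \<open>[x, i]\<close> with \<open>0 \<le> x \<sqdot> v < v\<^sub>i\<close>. A dual substitution with incidence matrix \<open>M\<close> maps
  \<open>plane v\<close> to \<open>plane (M\<^sup>T v)\<close>, and each face \<open>[y, j]\<close> of the image has an ancestor
  \<open>[M y - P(s), i]\<close> in \<open>plane v\<close>. Each seed is, up to a few faces, the set of the faces
  of a plane whose vector has sup norm at most 1, so it suffices to follow the ancestors of a face
  of sup norm \<open>R\<close> down to the seed. For both families \<open>M y - P(s)\<close> keeps all but one
  coordinate of \<open>y\<close>, up to order, and the inequalities defining the plane show that the new
  coordinate never increases the sup norm \<open>K\<close>. The new coordinate can be \<open>K\<close> or \<open>-K\<close> only in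
  rigid configurations, which cannot recur: if \<open>K \<ge> 2\<close>, then the norm drops after 8 letters 3
  (Brun), respectively 8 steps (Jacobi-Perron).

  Since every edge of a discrete plane lies in exactly two of its faces, a pattern that contains
  all faces of sup norm at most \<open>R\<close> has radius at least \<open>R\<close>.
\<close>

section \<open>Discrete planes and the radius\<close>

definition dot :: "int ^ 3 \<Rightarrow> int ^ 3 \<Rightarrow> int" where
  "dot x v = (\<Sum>i\<in>UNIV. x $ i * v $ i)"

definition plane :: "int ^ 3 \<Rightarrow> pattern" where
  "plane v = {(x, i). 0 \<le> dot x v \<and> dot x v < v $ i}"

lemma in_plane [simp]: "(x, i) \<in> plane v \<longleftrightarrow> 0 \<le> dot x v \<and> dot x v < v $ i"
  by (simp add: plane_def)

lemma dot_3: "dot x v = x $ 1 * v $ 1 + x $ 2 * v $ 2 + x $ 3 * v $ 3"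
  by (simp add: dot_def sum_3)

lemma dot_add: "dot (x + y) v = dot x v + dot y v"
  by (simp add: dot_def distrib_right sum.distrib)

lemma dot_diff: "dot (x - y) v = dot x v - dot y v"
  by (simp add: dot_def left_diff_distrib sum_subtractf)

lemma dot_axis: "dot (axis i 1) v = v $ i"
  by (simp add: dot_def axis_def if_distrib [of "\<lambda>c. c * _"] cong: if_cong)

section \<open>Unit edges of the integer grid and their incidence with faces\<close>

definition segment :: "int ^ 3 \<Rightarrow> 3 \<Rightarrow> (real ^ 3) set" where
  "segment y k = closed_segment (point y) (point (y + axis k 1))"

lemma point_add: "point (x + y) = point x + point y"
  by (simp add: point_def vec_eq_iff)

lemma point_axis: "point (axis k 1) = axis k 1"
  by (simp add: point_def vec_eq_iff axis_def)

lemma point_nth [simp]: "point x $ i = real_of_int (x $ i)"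
  by (simp add: point_def)

lemma in_segment:
  "p \<in> segment y k \<longleftrightarrow> (\<exists>t. 0 \<le> t \<and> t \<le> 1 \<and> p = point y + t *\<^sub>R axis k 1)"
proof -
  have "(1 - t) *\<^sub>R point y + t *\<^sub>R point (y + axis k 1) = point y + t *\<^sub>R axis k 1" for t
    by (simp add: point_add point_axis algebra_simps)
  then show ?thesis
    by (simp add: segment_def closed_segment_def conj_ac)
qed

text \<open>A point of a unit edge has integer coordinates except in the direction of the edge, and
  the midpoint has a half-integer there. A unit edge is thus recognised by its midpoint, which turns
  equalities and unions of edges into statements about pairs \<open>(y, k)\<close>.\<close>

lemma segment_midpoint_unique:
  assumes "point y + (1/2) *\<^sub>R axis k 1 \<in> segment z l"
  shows "y = z \<and> k = l"
proof -
  obtain t where t: "0 \<le> t" "t \<le> 1" "point y + (1/2) *\<^sub>R axis k 1 = point z + t *\<^sub>R axis l 1"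
    using assms by (auto simp: in_segment)
  have comp: "real_of_int (y $ c) + (if c = k then 1/2 else 0) =
      real_of_int (z $ c) + (if c = l then t else 0)" for c
    using arg_cong [OF t(3), of "\<lambda>p. p $ c"] by (auto simp: axis_def split: if_splits)
  have half: "real_of_int a + 1/2 \<noteq> real_of_int b" for a b
  proof
    assume "real_of_int a + 1/2 = real_of_int b"
    then have "real_of_int (2 * a + 1) = real_of_int (2 * b)" by simp
    then show False by (metis of_int_eq_iff even_mult_iff even_numeral odd_one odd_add)
  qed
  have "k = l"
    using comp [of k] half [of "y $ k" "z $ k"] by (auto split: if_splits)
  moreover have "y $ c = z $ c" for c
  proof (cases "c = k")
    case True
    then have "real_of_int (y $ c - z $ c) = t - 1/2"
      using comp [of c] \<open>k = l\<close> by simp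
    then have "\<bar>real_of_int (y $ c - z $ c)\<bar> < 1"
      using t(1,2) by simp
    then show ?thesis by linarith
  qed (use comp [of c] \<open>k = l\<close> in simp)
  ultimately show ?thesis by (simp add: vec_eq_iff)
qed

lemma midpoint_in_segment: "point y + (1/2) *\<^sub>R axis k 1 \<in> segment y k"
  unfolding in_segment by (rule exI [of _ "1/2"]) simp

definition incident :: "int ^ 3 \<Rightarrow> 3 \<Rightarrow> face \<Rightarrow> bool" where
  "incident y k f \<longleftrightarrow> (\<exists>j. {snd f, j, k} = UNIV \<and> y \<in> {fst f, fst f + axis j 1})"

lemma incidentI: "{i, j, k} = UNIV \<Longrightarrow> y = x \<or> y = x + axis j 1 \<Longrightarrow> incident y k (x, i)"
  unfolding incident_def by (intro exI [of _ j]) simp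

lemma edges_iff: "e \<in> edges f \<longleftrightarrow> (\<exists>y k. e = segment y k \<and> incident y k f)"
  by (cases f) (auto simp: edges_def incident_def segment_def)

lemma segment_in_edges [simp]: "segment y k \<in> edges f \<longleftrightarrow> incident y k f"
  using segment_midpoint_unique midpoint_in_segment by (metis edges_iff)

lemma distinct_if_UNIV:
  assumes "{i, j, k} = (UNIV :: 3 set)"
  shows "i \<noteq> j" "j \<noteq> k" "i \<noteq> k" "c = i \<or> c = j \<or> c = k"
proof -
  have "card {i, j, k} = 3" using assms by simp
  then show "i \<noteq> j" "j \<noteq> k" "i \<noteq> k" by (auto simp: card_insert_if split: if_splits)
  show "c = i \<or> c = j \<or> c = k" using assms by blast
qed

lemma third_index:
  assumes "i \<noteq> (k :: 3)"
  obtains j where "{i, j, k} = UNIV"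
  using assms exhaust_3 [of i] exhaust_3 [of k] that[of 1] that[of 2] that[of 3]
  by (auto simp: UNIV_3 insert_commute)

text \<open>\<open>boundary\<close> counts faces by inclusion in squares, while paths use membership
  in \<open>edges\<close>; both reduce to \<open>incident\<close>. On the square, coordinate
  \<open>i\<close> is constant and every coordinate varies by at most 1, so comparing both endpoints
  of the segment leaves only the four sides.\<close>

lemma segment_subset_square [simp]: "segment y k \<subseteq> square f \<longleftrightarrow> incident y k f"
proof
  obtain x i where f: "f = (x, i)" by force
  {
    assume sub: "segment y k \<subseteq> square f"
    have bnd: "p $ i = x $ i \<and> (\<forall>c. x $ c \<le> p $ c \<and> p $ c \<le> x $ c + 1)" if "p \<in> square f" for p
      using that distinct_if_UNIV unfolding f square_def
      by (auto simp: axis_def)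
    have P: "p \<in> {point y, point (y + axis k 1)} \<Longrightarrow> p \<in> square f" for p
      using sub by (auto simp: segment_def)
    have 1: "y $ i = x $ i" "x $ c \<le> y $ c" "y $ c \<le> x $ c + 1" for c
      using bnd [OF P, of "point y"] by (simp_all del: of_int_add)
    have 2: "(y + axis k 1) $ i = x $ i" "(y + axis k 1) $ c \<le> x $ c + 1" for c
      using bnd [OF P, of "point (y + axis k 1)"] by (simp_all del: of_int_add vector_add_component)
    have "i \<noteq> k" using 1 2(1) by (auto simp: axis_def)
    then obtain j where j: "{i, j, k} = UNIV" by (rule third_index)
    have yk: "y $ k = x $ k" using 1(2) [of k] 2(2) [of k] by (simp add: axis_def)
    have "y $ j = x $ j \<or> y $ j = x $ j + 1" using 1(2,3) [of j] by linarith
    then have "y = x \<or> y = x + axis j 1"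
    proof
      assume "y $ j = x $ j"
      then have "y $ c = x $ c" for c
        using 1(1) yk distinct_if_UNIV(4) [OF j, of c] by auto
      then show ?thesis by (simp add: vec_eq_iff)
    next
      assume "y $ j = x $ j + 1"
      then have "y $ c = (x + axis j 1) $ c" for c
        using 1(1) yk distinct_if_UNIV(1,2) [OF j] distinct_if_UNIV(4) [OF j, of c]
        by (auto simp: axis_def)
      then show ?thesis by (simp add: vec_eq_iff)
    qed
    then show "incident y k f" using j f by (auto simp: incident_def)
  next
    assume "incident y k f"
    then obtain j where j: "{i, j, k} = UNIV" and y: "y = x \<or> y = x + axis j 1"
      by (auto simp: incident_def f)
    then obtain l :: real where l: "0 \<le> l" "l \<le> 1" "point y = point x + l *\<^sub>R axis j 1"
    proof -
      assume *: "\<And>l :: real. 0 \<le> l \<Longrightarrow> l \<le> 1 \<Longrightarrow> point y = point x + l *\<^sub>R axis j 1 \<Longrightarrow> thesis"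
      show thesis
        using y *[of 0] *[of 1] by (auto simp: point_add point_axis)
    qed
    show "segment y k \<subseteq> square f"
      using l j unfolding f square_def by (fastforce simp: in_segment)
  }
qed

text \<open>A union of edges could cover an edge that is not one of them. The midpoint rules this
  out, as it lies on a single unit edge.\<close>

lemma segment_subset_boundary:
  "segment y k \<subseteq> boundary P \<longleftrightarrow> (\<exists>!g. g \<in> P \<and> incident y k g)"
proof
  assume "segment y k \<subseteq> boundary P"
  then have "point y + (1/2) *\<^sub>R axis k 1 \<in> boundary P"
    using midpoint_in_segment by (rule subsetD)
  then obtain e where e: "point y + (1/2) *\<^sub>R axis k 1 \<in> e" "\<exists>f\<in>P. e \<in> edges f"
      and unique: "\<exists>!g. g \<in> P \<and> e \<subseteq> square g"
    unfolding boundary_def by (elim UnionE CollectE conjE)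
  then obtain z l where zl: "e = segment z l" by (auto simp: edges_iff)
  then have "e = segment y k"
    using e(1) segment_midpoint_unique [of y k z l] by simp
  then show "\<exists>!g. g \<in> P \<and> incident y k g" using unique by simp
next
  assume *: "\<exists>!g. g \<in> P \<and> incident y k g"
  then have "\<exists>f\<in>P. segment y k \<in> edges f" by auto
  moreover have "\<exists>!g. g \<in> P \<and> segment y k \<subseteq> square g" using * by simp
  ultimately show "segment y k \<subseteq> boundary P"
    unfolding boundary_def by (intro Union_upper CollectI conjI)
qed

lemma share_edge_iff: "share_edge f g \<longleftrightarrow> (\<exists>y k. incident y k f \<and> incident y k g)"
proof
  assume "share_edge f g"
  then obtain e where e: "e \<in> edges f" "e \<in> edges g" by (auto simp: share_edge_def)
  then obtain y k where "e = segment y k" by (auto simp: edges_iff)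
  then show "\<exists>y k. incident y k f \<and> incident y k g" using e by auto
next
  assume "\<exists>y k. incident y k f \<and> incident y k g"
  then obtain y k where "segment y k \<in> edges f" "segment y k \<in> edges g" by auto
  then show "share_edge f g" unfolding share_edge_def by blast
qed

text \<open>Four squares of the grid contain the edge. Among them \<open>(y, i)\<close> is in the
  plane iff \<open>dot y v < v $ i\<close>, and \<open>(y - axis i 1, j)\<close> iff
  \<open>v $ i <= dot y v\<close>, so this pair contributes one face. The other pair arises by
  exchanging \<open>i\<close> and \<open>j\<close>.\<close>

lemma plane_faces_at_edge:
  assumes ijk: "{i, j, k} = UNIV" and pos: "0 < v $ i" "0 < v $ j"
    and t: "0 \<le> dot y v" "dot y v < v $ i + v $ j"
  shows "g \<in> plane v \<and> incident y k g \<longleftrightarrow>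
    g = (if dot y v < v $ i then (y, i) else (y - axis i 1, j)) \<or>
    g = (if dot y v < v $ j then (y, j) else (y - axis j 1, i))"
proof -
  obtain x l where g: "g = (x, l)" by force
  have "incident y k g \<longleftrightarrow> g \<in> {(y, i), (y - axis j 1, i), (y, j), (y - axis i 1, j)}"
  proof
    assume "incident y k g"
    then obtain m where m: "{l, m, k} = UNIV" "y = x \<or> y = x + axis m 1"
      by (auto simp: incident_def g)
    have "l = i \<and> m = j \<or> l = j \<and> m = i"
      using distinct_if_UNIV(4) [OF ijk, of l] distinct_if_UNIV(4) [OF ijk, of m]
        distinct_if_UNIV(1-3) [OF m(1)] by blast
    then show "g \<in> {(y, i), (y - axis j 1, i), (y, j), (y - axis i 1, j)}"
      using m(2) g by auto
  next
    assume "g \<in> {(y, i), (y - axis j 1, i), (y, j), (y - axis i 1, j)}"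
    moreover have "{j, i, k} = UNIV" using ijk by blast
    ultimately show "incident y k g"
      using incidentI [OF ijk] incidentI [of j i k] by auto
  qed
  then show ?thesis
    using t pos distinct_if_UNIV(1) [OF ijk] by (auto simp: dot_diff dot_axis)
qed

lemma incident_plane_bounds:
  assumes "(x, i) \<in> plane v" "incident y k (x, i)" "\<And>i. 0 < v $ i"
  obtains j where "{i, j, k} = UNIV" "0 \<le> dot y v" "dot y v < v $ i + v $ j"
proof -
  obtain j where "{i, j, k} = UNIV" "y = x \<or> y = x + axis j 1"
    using assms(2) by (auto simp: incident_def)
  then show thesis
    using that [of j] assms(1) assms(3) [of j] by (auto simp: dot_add dot_axis)
qed

lemma other_face_at_edge:
  assumes "f \<in> plane v" "incident y k f" and pos: "\<And>i. 0 < v $ i"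
  obtains g where "g \<in> plane v" "incident y k g" "g \<noteq> f"
proof -
  obtain x i where f: "f = (x, i)" by force
  obtain j where j: "{i, j, k} = UNIV" "0 \<le> dot y v" "dot y v < v $ i + v $ j"
    using assms f by (metis incident_plane_bounds)
  let ?A = "if dot y v < v $ i then (y, i) else (y - axis i 1, j)"
  let ?B = "if dot y v < v $ j then (y, j) else (y - axis j 1, i)"
  have iff: "g \<in> plane v \<and> incident y k g \<longleftrightarrow> g = ?A \<or> g = ?B" for g
    by (rule plane_faces_at_edge) (use j pos in auto)
  have "?A \<noteq> ?B"
    using distinct_if_UNIV(1) [OF j(1)] by (auto simp: axis_eq_0_iff)
  then show thesis
    by (cases "f = ?A") (use that [of ?A] that [of ?B] iff [of ?A] iff [of ?B] in metis)+
qed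

section \<open>Paths of faces and the lower bound on the radius\<close>

definition sup_bounded :: "int \<Rightarrow> face \<Rightarrow> bool" where
  "sup_bounded K f \<longleftrightarrow> (\<forall>c. \<bar>fst f $ c\<bar> \<le> K)"

lemma sup_bounded_incident:
  assumes "incident y k f" "incident y k g" "sup_bounded K f"
  shows "sup_bounded (K + 1) g"
proof -
  have *: "fst h $ c \<le> y $ c \<and> y $ c \<le> fst h $ c + 1" if "incident y k h" for h c
    using that by (auto simp: incident_def axis_def)
  have "\<bar>fst g $ c\<bar> \<le> K + 1" for c
  proof -
    have "\<bar>fst f $ c\<bar> \<le> K" using assms(3) by (simp add: sup_bounded_def)
    then show ?thesis using * [OF assms(1), of c] * [OF assms(2), of c] by linarith
  qed
  then show ?thesis by (simp add: sup_bounded_def)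
qed

lemma sup_bounded_path:
  assumes "fs \<noteq> []" "hd fs \<in> unit_pattern" "successively share_edge fs"
  shows "sup_bounded (int (length fs) - 1) (last fs)"
  using assms
proof (induction fs rule: rev_nonempty_induct)
  case (single f)
  then show ?case by (auto simp: unit_pattern_def sup_bounded_def)
next
  case (snoc f fs)
  then have "sup_bounded (int (length fs) - 1) (last fs)" "share_edge (last fs) f"
    by (auto simp: successively_append_iff)
  then show ?case
    by (force simp: share_edge_iff dest: sup_bounded_incident)
qed

text \<open>The infimum in \<open>rad\<close> is 0 on the empty set, so some path to the boundary
  must be exhibited. Otherwise the faces reachable from the unit pattern would be closed under
  crossing edges within the plane; but a walk across edges of direction 3, through faces of types 1
  and 2, never returns, against finiteness.\<close>

lemma boundary_path_exists:
  assumes fin: "finite P" and U: "unit_pattern \<subseteq> P" and sub: "P \<subseteq> plane v"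
    and pos: "\<And>i. 0 < v $ i"
  obtains fs where "fs \<noteq> []" "set fs \<subseteq> P" "hd fs \<in> unit_pattern" "successively share_edge fs"
    "\<exists>e \<in> edges (last fs). e \<subseteq> boundary P"
proof (rule ccontr)
  note that' = that
  assume none: "\<not> thesis"
  define C where "C = {last fs | fs. fs \<noteq> [] \<and> set fs \<subseteq> P \<and> hd fs \<in> unit_pattern \<and>
    successively share_edge fs}"
  have CP: "C \<subseteq> P" by (auto simp: C_def)
  \<comment> \<open>The edge is not in the boundary, so a second face of \<open>P\<close> contains
    it. The plane has only two faces at this edge, hence that face is \<open>g\<close>.\<close>
  have step: "g \<in> C" if *: "f \<in> C" "incident y k f" "incident y k g" "g \<in> plane v" "g \<noteq> f"
    "{i, j, k} = UNIV" "0 \<le> dot y v" "dot y v < v $ i + v $ j" for f g y i j k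
  proof -
    obtain fs where fs: "f = last fs" "fs \<noteq> []" "set fs \<subseteq> P" "hd fs \<in> unit_pattern"
      "successively share_edge fs"
      using *(1) unfolding C_def by blast
    then have "\<not> segment y k \<subseteq> boundary P"
      using none that' *(2) by (metis segment_in_edges)
    moreover have "f \<in> P" using *(1) CP by blast
    ultimately obtain h where h: "h \<in> P" "incident y k h" "h \<noteq> f"
      using *(2) unfolding segment_subset_boundary by blast
    obtain A B where iff: "g \<in> plane v \<and> incident y k g \<longleftrightarrow> g = A \<or> g = B" for g
      using plane_faces_at_edge [OF *(6) pos pos *(7,8)] by blast
    have "h = g"
      using iff [of f] iff [of g] iff [of h] *(2-5) h sub \<open>f \<in> P\<close> by blast
    then have "set (fs @ [g]) \<subseteq> P" "successively share_edge (fs @ [g])"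
      using fs h(1) *(2,3) by (auto simp: successively_append_iff share_edge_iff)
    then show "g \<in> C"
      using fs unfolding C_def by (intro CollectI exI [of _ "fs @ [g]"]) auto
  qed
  \<comment> \<open>Each crossing used below raises this potential by 1, 2 or 3, so no face of
    \<open>C\<close> of type 1 or 2 can maximise it.\<close>
  define \<phi> :: "face \<Rightarrow> int" where
    "\<phi> f = 2 * (fst f $ 2 - fst f $ 1) + (if snd f = 1 then 1 else 0)" for f
  have "(0, 1) \<in> C"
    using U unfolding C_def by (intro CollectI exI [of _ "[(0, 1)]"]) (auto simp: unit_pattern_def)
  then have ne: "\<phi> ` (C \<inter> {f. snd f \<noteq> 3}) \<noteq> {}" "finite (\<phi> ` (C \<inter> {f. snd f \<noteq> 3}))"
    using fin CP by (auto intro: finite_subset)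
  obtain f where f: "f \<in> C" "snd f \<noteq> 3" "\<phi> f = Max (\<phi> ` (C \<inter> {f. snd f \<noteq> 3}))"
    using Max_in [OF ne(2,1)] by auto
  have max: "\<phi> g \<le> \<phi> f" if "g \<in> C" "snd g \<noteq> 3" for g
    using that ne f by auto
  obtain x i where xi: "f = (x, i)" by force
  have fpl: "0 \<le> dot x v" "dot x v < v $ i" using f(1) CP sub xi by auto
  have UN: "{1, 2, 3} = (UNIV :: 3 set)" by (simp add: UNIV_3)
  show False
  proof (cases "i = 1")
    case True
    define y where "y = x + axis 2 1"
    have t: "0 \<le> dot y v" "dot y v < v $ 1 + v $ 2" "\<not> dot y v < v $ 2"
      using fpl pos [of 2] True by (auto simp: y_def dot_add dot_axis)
    define g where "g = (if dot y v < v $ 1 then (y, 1) else (y - axis 1 1, 2 :: 3))"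
    have "f = (y - axis 2 1, 1)" by (simp add: xi True y_def)
    then have "h \<in> plane v \<and> incident y 3 h \<longleftrightarrow> h = g \<or> h = f" for h
      using plane_faces_at_edge [OF UN pos pos t(1,2)] t(3) by (simp add: g_def)
    then have "g \<in> plane v" "incident y 3 g" "incident y 3 f" by blast+
    moreover have "snd g \<noteq> 3" "\<phi> f < \<phi> g"
      by (simp_all add: g_def xi True y_def \<phi>_def axis_def)
    moreover from this have "g \<noteq> f" by blast
    ultimately show False
      using step [OF f(1) _ _ _ _ UN t(1,2), of g] max [of g] by linarith
  next
    case False
    then have i2: "i = 2" using f(2) xi exhaust_3 [of i] by auto
    have t: "0 \<le> dot x v" "dot x v < v $ 1 + v $ 2" "dot x v < v $ 2"
      using fpl pos [of 1] i2 by auto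
    define g where "g = (if dot x v < v $ 1 then (x, 1) else (x - axis 1 1, 2 :: 3))"
    have "h \<in> plane v \<and> incident x 3 h \<longleftrightarrow> h = g \<or> h = f" for h
      using plane_faces_at_edge [OF UN pos pos t(1,2)] t(3) by (simp add: g_def xi i2)
    then have "g \<in> plane v" "incident x 3 g" "incident x 3 f" by blast+
    moreover have "snd g \<noteq> 3" "\<phi> f < \<phi> g"
      by (simp_all add: g_def xi i2 \<phi>_def axis_def)
    moreover from this have "g \<noteq> f" by blast
    ultimately show False
      using step [OF f(1) _ _ _ _ UN t(1,2), of g] max [of g] by linarith
  qed
qed

text \<open>A path of \<open>m\<close> faces starts at sup norm 0 and gains at most 1 per shared
  edge. At a boundary edge of its last face, the second face of the plane is outside
  \<open>P\<close>, hence of norm above \<open>R\<close>, yet it is reached with norm at most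
  \<open>m\<close>.\<close>

lemma rad_ge:
  assumes "finite P" "unit_pattern \<subseteq> P" and sub: "P \<subseteq> plane v"
    and pos: "\<And>i. 0 < v $ i"
    and ball: "\<And>f. f \<in> plane v \<Longrightarrow> sup_bounded (int R) f \<Longrightarrow> f \<in> P"
  shows "R \<le> rad P"
  unfolding rad_def
proof (rule cInf_greatest, goal_cases)
  case 1
  obtain fs where "fs \<noteq> []" "set fs \<subseteq> P" "hd fs \<in> unit_pattern" "successively share_edge fs"
    "\<exists>e \<in> edges (last fs). e \<subseteq> boundary P"
    using boundary_path_exists [OF assms(1-4)] .
  then have "length fs \<in> {length fs |fs. fs \<noteq> [] \<and> set fs \<subseteq> P \<and> hd fs \<in> unit_pattern \<and>
      successively share_edge fs \<and> (\<exists>e\<in>edges (last fs). e \<subseteq> boundary P)}"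
    by (intro CollectI exI [of _ fs]) simp
  then show ?case by (metis empty_iff)
next
  case (2 m)
  then obtain fs where fs: "m = length fs" "fs \<noteq> []" "set fs \<subseteq> P" "hd fs \<in> unit_pattern"
      "successively share_edge fs" and "\<exists>e \<in> edges (last fs). e \<subseteq> boundary P"
    by (elim CollectE exE conjE)
  then obtain y k where e: "incident y k (last fs)" "segment y k \<subseteq> boundary P"
    by (metis edges_iff)
  have last: "last fs \<in> P" using fs by auto
  then obtain g where g: "g \<in> plane v" "incident y k g" "g \<noteq> last fs"
    using other_face_at_edge [OF _ e(1) pos] sub by blast
  have "g \<notin> P" using e g last by (auto simp: segment_subset_boundary)
  then have "\<not> sup_bounded (int R) g" using ball g by blast
  moreover have "sup_bounded (int m) g"
    using sup_bounded_incident [OF e(1) g(2) sup_bounded_path [OF fs(2,4,5)]] fs(1) by simp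
  ultimately have "\<not> int m \<le> int R"
    unfolding sup_bounded_def by (meson order_trans)
  then show ?case by simp
qed

section \<open>Ancestors\<close>

text \<open>The transposed incidence matrix applied to \<open>v\<close>, written as the weight of
  the word \<open>\<sigma> j\<close>; \<open>dot_push\<close> is the adjointness.\<close>

definition push :: "subst \<Rightarrow> int ^ 3 \<Rightarrow> int ^ 3" where
  "push \<sigma> v = (\<chi> j. \<Sum>i\<leftarrow>\<sigma> j. v $ i)"

lemma push_nth: "push \<sigma> v $ j = (\<Sum>i\<leftarrow>\<sigma> j. v $ i)"
  by (simp add: push_def)

lemma dot_abelianization: "dot (abelianization w) v = (\<Sum>i\<leftarrow>w. v $ i)"
proof (induction w)
  case Nil
  then show ?case by (simp add: abelianization_def dot_def)
next
  case (Cons a w)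
  have "abelianization (a # w) = axis a 1 + abelianization w"
    by (simp add: abelianization_def axis_def vec_eq_iff)
  then show ?case using Cons by (simp add: dot_add dot_axis)
qed

lemma dot_push: "dot y (push \<sigma> v) = dot (incidence_matrix \<sigma> *v y) v"
proof -
  have "dot y (push \<sigma> v) = (\<Sum>c\<in>UNIV. \<Sum>r\<in>UNIV. y $ c * (abelianization (\<sigma> c) $ r * v $ r))"
    by (simp add: dot_def push_def sum_distrib_left flip: dot_abelianization)
  also have "\<dots> = (\<Sum>r\<in>UNIV. \<Sum>c\<in>UNIV. y $ c * (abelianization (\<sigma> c) $ r * v $ r))"
    by (rule sum.swap)
  finally show ?thesis
    by (simp add: dot_def incidence_matrix_def matrix_vector_mult_def sum_distrib_left
        sum_distrib_right mult_ac)
qed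

lemma in_dual_face:
  assumes "invertible (incidence_matrix \<sigma>)"
  shows "(y, j) \<in> dual_face \<sigma> (x, i) \<longleftrightarrow>
    (\<exists>p s. \<sigma> j = p @ i # s \<and> incidence_matrix \<sigma> *v y = x + abelianization s)"
proof -
  let ?M = "incidence_matrix \<sigma>"
  have "?M ** matrix_inv ?M = mat 1 \<and> matrix_inv ?M ** ?M = mat 1"
    unfolding matrix_inv_def by (rule someI_ex) (use assms in \<open>simp add: invertible_def\<close>)
  then have "y = matrix_inv ?M *v z \<longleftrightarrow> ?M *v y = z" for y z
    by (metis matrix_vector_mul_assoc matrix_vector_mul_lid)
  then show ?thesis by (auto simp: dual_face_def)
qed

lemma dual_subst_plane:
  assumes inv: "invertible (incidence_matrix \<sigma>)" and pos: "\<And>i. 0 < v $ i" and P: "P \<subseteq> plane v"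
  shows "dual_subst \<sigma> P \<subseteq> plane (push \<sigma> v)"
proof
  fix f assume "f \<in> dual_subst \<sigma> P"
  then obtain x i y j where f: "f = (y, j)" "(y, j) \<in> dual_face \<sigma> (x, i)" and "(x, i) \<in> P"
    unfolding dual_subst_def by (cases f) auto
  then have xi: "(x, i) \<in> plane v" using P by blast
  obtain p s where s: "\<sigma> j = p @ i # s" "incidence_matrix \<sigma> *v y = x + abelianization s"
    using f(2) in_dual_face [OF inv] by blast
  have "0 \<le> (\<Sum>i\<leftarrow>w. v $ i)" for w
    using pos by (induction w) (auto simp: less_imp_le)
  then have "0 \<le> (\<Sum>i\<leftarrow>p. v $ i)" "0 \<le> (\<Sum>i\<leftarrow>s. v $ i)" by auto
  then show "f \<in> plane (push \<sigma> v)"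
    using xi s f by (auto simp: dot_push dot_add dot_abelianization push_nth)
qed

text \<open>The suffixes of \<open>w\<close> cut the interval from 0 to the weight of
  \<open>w\<close> into consecutive intervals, one per letter and as long as its weight;
  \<open>t\<close> falls into one of them.\<close>

lemma split_word:
  fixes v :: "int ^ 3"
  assumes "0 \<le> t" "t < (\<Sum>i\<leftarrow>w. v $ i)"
  obtains p i s where "w = p @ i # s" "(\<Sum>i\<leftarrow>s. v $ i) \<le> t" "t < (\<Sum>i\<leftarrow>s. v $ i) + v $ i"
  using assms
proof (induction w arbitrary: thesis)
  case (Cons a w)
  show ?case
  proof (cases "t < (\<Sum>i\<leftarrow>w. v $ i)")
    case True
    then obtain p i s where "w = p @ i # s" "(\<Sum>i\<leftarrow>s. v $ i) \<le> t" "t < (\<Sum>i\<leftarrow>s. v $ i) + v $ i"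
      using Cons.IH Cons.prems(2) by blast
    then show ?thesis using Cons.prems(1) [of "a # p" i s] by simp
  next
    case False
    then show ?thesis using Cons.prems(3) by (intro Cons.prems(1) [of "[]" a w]) auto
  qed
qed simp

text \<open>The height of \<open>M y\<close> over the plane is the height of \<open>y\<close> for
  the pushed weights, hence below the weight of \<open>\<sigma> j\<close>. The letter
  \<open>i\<close> whose interval contains it gives the ancestor, since subtracting the suffix
  brings the height into the range from 0 to \<open>v $ i\<close>.\<close>

lemma ancestor:
  assumes inv: "invertible (incidence_matrix \<sigma>)" and f: "(y, j) \<in> plane (push \<sigma> v)"
  obtains p i s where "\<sigma> j = p @ i # s"
    "(incidence_matrix \<sigma> *v y - abelianization s, i) \<in> plane v"
    "(y, j) \<in> dual_face \<sigma> (incidence_matrix \<sigma> *v y - abelianization s, i)"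
proof -
  let ?t = "dot (incidence_matrix \<sigma> *v y) v"
  obtain p i s where *: "\<sigma> j = p @ i # s"
    "(\<Sum>i\<leftarrow>s. v $ i) \<le> ?t" "?t < (\<Sum>i\<leftarrow>s. v $ i) + v $ i"
    using split_word [of ?t v "\<sigma> j"] f by (auto simp: dot_push push_nth)
  show thesis
    using * by (intro that [OF *(1)])
      (auto simp: dot_diff dot_abelianization in_dual_face [OF inv])
qed

section \<open>The Brun and Jacobi-Perron substitutions in coordinates\<close>

lemma matrix_vector_mult_3:
  "(A *v x) $ r = A $ r $ 1 * x $ 1 + A $ r $ 2 * x $ 2 + A $ r $ (3 :: 3) * x $ 3"
  by (simp add: matrix_vector_mult_def sum_3)

lemma invertibleI_3:
  fixes A B :: "int ^ 3 ^ 3"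
  assumes "\<And>x. A *v (B *v x) = x" "\<And>x. B *v (A *v x) = x"
  shows "invertible A"
  unfolding invertible_def
  by (rule exI [of _ B]) (simp add: matrix_eq assms flip: matrix_vector_mul_assoc)

lemma vec_eq_3: "(x :: 'a ^ 3) = y \<longleftrightarrow> x $ 1 = y $ 1 \<and> x $ 2 = y $ 2 \<and> x $ 3 = y $ 3"
  by (simp add: vec_eq_iff forall_3)

lemma incidence_nth: "incidence_matrix \<sigma> $ r $ c = int (count_list (\<sigma> c) r)"
  by (simp add: incidence_matrix_def abelianization_def)

lemma subst_Br_nth:
  "subst_Br 1 1 = [1]" "subst_Br 1 2 = [2]" "subst_Br 1 3 = [3, 2]"
  "subst_Br 2 1 = [1]" "subst_Br 2 2 = [3]" "subst_Br 2 3 = [2, 3]"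
  "subst_Br 3 1 = [2]" "subst_Br 3 2 = [3]" "subst_Br 3 3 = [1, 3]"
  by (simp_all add: subst_Br_def mk_subst_def)

lemma subst_JP_nth:
  "subst_JP a b 1 = [3]" "subst_JP a b 2 = 1 # replicate a 3" "subst_JP a b 3 = 2 # replicate b 3"
  by (simp_all add: subst_JP_def mk_subst_def)

lemma invertible_Br: "invertible (incidence_matrix (subst_Br c))"
proof -
  have "invertible (incidence_matrix (subst_Br 1))"
    by (rule invertibleI_3 [of _ "vector [vector [1, 0, 0], vector [0, 1, -1], vector [0, 0, 1]]"])
      (simp_all add: vec_eq_3 matrix_vector_mult_3 incidence_nth subst_Br_nth)
  moreover have "invertible (incidence_matrix (subst_Br 2))"
    by (rule invertibleI_3 [of _ "vector [vector [1, 0, 0], vector [0, -1, 1], vector [0, 1, 0]]"])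
      (simp_all add: vec_eq_3 matrix_vector_mult_3 incidence_nth subst_Br_nth)
  moreover have "invertible (incidence_matrix (subst_Br 3))"
    by (rule invertibleI_3 [of _ "vector [vector [0, 1, 0], vector [-1, 0, 1], vector [1, 0, 0]]"])
      (simp_all add: vec_eq_3 matrix_vector_mult_3 incidence_nth subst_Br_nth)
  ultimately show ?thesis using exhaust_3 [of c] by metis
qed

lemma invertible_JP: "invertible (incidence_matrix (subst_JP a b))"
  by (rule invertibleI_3 [of _
        "vector [vector [- int a, - int b, 1], vector [1, 0, 0], vector [0, 1, 0]]"])
    (simp_all add: vec_eq_3 matrix_vector_mult_3 incidence_nth subst_JP_nth count_list_replicate)

lemma push_Br:
  "push (subst_Br 1) v = vector [v $ 1, v $ 2, v $ 2 + v $ 3]"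
  "push (subst_Br 2) v = vector [v $ 1, v $ 3, v $ 2 + v $ 3]"
  "push (subst_Br 3) v = vector [v $ 2, v $ 3, v $ 1 + v $ 3]"
  by (simp_all add: push_def vec_eq_3 subst_Br_nth)

lemma push_JP:
  "push (subst_JP a b) v = vector [v $ 3, v $ 1 + int a * v $ 3, v $ 2 + int b * v $ 3]"
  by (simp add: push_def vec_eq_3 subst_JP_nth sum_list_replicate)

text \<open>In the following two definitions, \<open>e\<close> and \<open>k\<close> are the length of the suffix \<open>s\<close> in the
  definition of the dual substitution.\<close>

definition move_Br :: "3 \<Rightarrow> face \<Rightarrow> face \<Rightarrow> bool" where
  "move_Br c = (\<lambda>(y, j) (x, i). \<exists>e.
     x = (if c = 1 then vector [y $ 1, y $ 2 + y $ 3 - e, y $ 3]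
       else if c = 2 then vector [y $ 1, y $ 3, y $ 2 + y $ 3 - e]
       else vector [y $ 3, y $ 1, y $ 2 + y $ 3 - e]) \<and>
     (c, j, e, i) \<in> {(1, 1, 0, 1), (1, 2, 0, 2), (1, 3, 1, 3), (1, 3, 0, 2),
       (2, 1, 0, 1), (2, 2, 0, 3), (2, 3, 1, 2), (2, 3, 0, 3),
       (3, 1, 0, 2), (3, 2, 0, 3), (3, 3, 1, 1), (3, 3, 0, 3)})"

definition move_JP :: "nat \<Rightarrow> nat \<Rightarrow> face \<Rightarrow> face \<Rightarrow> bool" where
  "move_JP a b = (\<lambda>(y, j) (x, i). \<exists>k::nat.
     x = vector [y $ 2, y $ 3, y $ 1 + int a * y $ 2 + int b * y $ 3 - int k] \<and>
     (j = 1 \<and> k = 0 \<and> i = 3 \<or> j = 2 \<and> k = a \<and> i = 1 \<or> j = 2 \<and> k < a \<and> i = 3 \<or>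
      j = 3 \<and> k = b \<and> i = 2 \<or> j = 3 \<and> k < b \<and> i = 3))"

lemma ancestor_Br:
  assumes "f \<in> plane (push (subst_Br c) v)"
  obtains g where "g \<in> plane v" "f \<in> dual_face (subst_Br c) g" "move_Br c f g"
proof -
  obtain y j where f: "f = (y, j)" by force
  obtain p i s where s: "subst_Br c j = p @ i # s"
    and g: "(incidence_matrix (subst_Br c) *v y - abelianization s, i) \<in> plane v"
      "(y, j) \<in> dual_face (subst_Br c) (incidence_matrix (subst_Br c) *v y - abelianization s, i)"
    using ancestor [OF invertible_Br, of y j c v] assms f by blast
  have "move_Br c f (incidence_matrix (subst_Br c) *v y - abelianization s, i)"
    using exhaust_3 [of c] exhaust_3 [of j] s
    by (elim disjE)
      (auto simp: f move_Br_def subst_Br_nth vec_eq_3 matrix_vector_mult_3 incidence_nth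
        abelianization_def Cons_eq_append_conv)
  then show thesis using that g f by blast
qed

lemma Cons_replicate_split:
  assumes "c # replicate n d = p @ i # s"
  obtains "i = c" "s = replicate n d" | k where "i = d" "s = replicate k d" "k < n"
proof (cases p)
  case Nil
  then show ?thesis using assms that(1) by simp
next
  case (Cons q p')
  then have eq: "replicate n d = p' @ i # s" using assms by simp
  then have "i = d" "set s \<subseteq> {d}"
    by (metis in_set_conv_decomp in_set_replicate, metis Un_iff in_set_replicate insertCI list.set(2) set_append subsetI singletonI)
  moreover have "length s < n" using arg_cong [OF eq, of length] by simp
  ultimately show ?thesis
    using that(2) [of "length s"] by (metis replicate_eqI subset_singletonD singletonD subsetD)
qed

lemma ancestor_JP:
  assumes "f \<in> plane (push (subst_JP a b) v)"
  obtains g where "g \<in> plane v" "f \<in> dual_face (subst_JP a b) g" "move_JP a b f g"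
proof -
  obtain y j where f: "f = (y, j)" by force
  obtain p i s where s: "subst_JP a b j = p @ i # s"
    and g: "(incidence_matrix (subst_JP a b) *v y - abelianization s, i) \<in> plane v"
      "(y, j) \<in> dual_face (subst_JP a b) (incidence_matrix (subst_JP a b) *v y - abelianization s, i)"
    using ancestor [OF invertible_JP, of y j a b v] assms f by blast
  have "\<exists>k. s = replicate k 3 \<and>
     (j = 1 \<and> k = 0 \<and> i = 3 \<or> j = 2 \<and> k = a \<and> i = 1 \<or> j = 2 \<and> k < a \<and> i = 3 \<or>
      j = 3 \<and> k = b \<and> i = 2 \<or> j = 3 \<and> k < b \<and> i = 3)"
    using exhaust_3 [of j]
  proof (elim disjE)
    assume "j = 1"
    then show ?thesis using s by (auto simp: subst_JP_nth Cons_eq_append_conv)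
  next
    assume j: "j = 2"
    then have "1 # replicate a 3 = p @ i # s" using s by (simp add: subst_JP_nth)
    then show ?thesis by (rule Cons_replicate_split) (use j in auto)
  next
    assume j: "j = 3"
    then have "2 # replicate b 3 = p @ i # s" using s by (simp add: subst_JP_nth)
    then show ?thesis by (rule Cons_replicate_split) (use j in auto)
  qed
  moreover have "incidence_matrix (subst_JP a b) *v y - abelianization (replicate k 3) =
      vector [y $ 2, y $ 3, y $ 1 + int a * y $ 2 + int b * y $ 3 - int k]" for k
    by (simp add: subst_JP_nth vec_eq_3 matrix_vector_mult_3 incidence_nth
        abelianization_def count_list_replicate)
  ultimately have "move_JP a b f (incidence_matrix (subst_JP a b) *v y - abelianization s, i)"
    unfolding move_JP_def f case_prod_conv by metis
  then show thesis using that g f by blast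
qed

section \<open>The new coordinate of an ancestor\<close>

text \<open>Here \<open>p\<close>, \<open>q\<close>, \<open>w\<close> are the weights of the plane of the ancestor that belong to the
  coordinates \<open>y1\<close>, \<open>n\<close>, \<open>y3\<close>, whatever their order.\<close>

lemma new_coordinate_Br:
  fixes p q w K y1 y2 y3 e n :: int
  assumes pq: "0 < p" "p < q" "0 < w" and K: "1 \<le> K"
    and y: "\<bar>y1\<bar> \<le> K" "\<bar>y2\<bar> \<le> K" "\<bar>y3\<bar> \<le> K" and e: "e = 0 \<or> e = 1"
    and n: "n = y2 + y3 - e"
    and lo: "0 \<le> y1 * p + y3 * w + n * q"
    and hi: "y1 * p + y3 * w + n * q < (if e = 0 then q else w)"
  shows "\<bar>n\<bar> \<le> K" "n = K \<Longrightarrow> y1 = -K \<and> 0 \<le> y3"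
    "n = -K \<Longrightarrow> y2 = -K \<and> y3 = 1 \<and> e = 1" "n = -K \<Longrightarrow> w < q \<Longrightarrow> y1 = K"
proof -
  have mono: "a * r \<le> b * r" if "a \<le> b" "0 < r" for a b r :: int
    using that by simp
  have hi': "y1 * p + y3 * w + n * q < q" if "e = 0"
    using hi that by simp
  have hi'': "y1 * p + y3 * w + n * q < w" if "e \<noteq> 0"
    using hi that by simp
  have Kpq: "K * p < K * q" using pq K by simp
  have y1: "-K * p \<le> y1 * p" "y1 * p \<le> K * p"
    using y(1) pq by (simp_all add: abs_le_iff del: mult_minus_left)
  \<comment> \<open>Such an \<open>n\<close> needs \<open>y3 >= 1\<close>. As \<open>p < q\<close>,
    the term \<open>y1 * p\<close> cannot offset \<open>K * q\<close>, and the value exceeds both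
    \<open>q\<close> and \<open>w\<close>.\<close>
  have "\<not> K + 1 \<le> n"
  proof
    assume "K + 1 \<le> n"
    then have "(K + 1) * q \<le> n * q" "1 * w \<le> y3 * w"
      using n e y pq by (auto intro!: mono)
    then show False
      using hi' hi'' y1 Kpq pq unfolding ring_distribs by linarith
  qed
  \<comment> \<open>If \<open>e = 1\<close>, then \<open>y3 >= 1\<close> and the value exceeds
    \<open>w\<close>. If \<open>e = 0\<close>, staying below \<open>q\<close> takes the extreme
    value \<open>y1 = -K\<close>, again because \<open>p < q\<close>.\<close>
  moreover have "e = 0 \<and> 0 \<le> y3 \<and> y1 = -K" if "n = K"
  proof -
    have "e = 0"
    proof (rule ccontr)
      assume "e \<noteq> 0"
      then have "1 * w \<le> y3 * w" using n e y pq that by (intro mono) auto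
      then show False using hi'' y1 Kpq \<open>e \<noteq> 0\<close> that unfolding ring_distribs by simp
    qed
    have "0 \<le> y3" using n y that \<open>e = 0\<close> by auto
    moreover have "y1 = -K"
    proof (rule ccontr)
      assume "y1 \<noteq> -K"
      then have "(1 - K) * p \<le> y1 * p" using y pq by (intro mono) auto
      moreover have "(K - 1) * p \<le> (K - 1) * q" using K pq by (intro mult_left_mono) auto
      moreover have "0 * w \<le> y3 * w" using \<open>0 \<le> y3\<close> pq by (intro mono) auto
      ultimately show False using hi' \<open>e = 0\<close> that unfolding ring_distribs by simp
    qed
    ultimately show ?thesis using \<open>e = 0\<close> by blast
  qed
  \<comment> \<open>Once \<open>y3 >= 1\<close>, the equation for \<open>n\<close> gives
    \<open>n >= -K\<close>, with equality only for \<open>y2 = -K\<close>, \<open>y3 = 1\<close>,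
    \<open>e = 1\<close>.\<close>
  moreover have "\<not> (n \<le> -K \<and> y3 \<le> 0)"
  proof
    assume "n \<le> -K \<and> y3 \<le> 0"
    then have "n * q \<le> -K * q" "y3 * w \<le> 0 * w"
      using mono [of n "-K" q] mono [of y3 0 w] pq by auto
    then show False using lo y1 Kpq by linarith
  qed
  moreover have "y1 = K" if "n = -K" "w < q" "y3 = 1"
  proof (rule ccontr)
    assume "y1 \<noteq> K"
    then have "y1 * p \<le> (K - 1) * p" using y pq by (intro mono) auto
    moreover have "(K - 1) * p \<le> (K - 1) * q" using K pq by (intro mult_left_mono) auto
    ultimately show False using lo that unfolding ring_distribs by simp
  qed
  ultimately show "\<bar>n\<bar> \<le> K" "n = K \<Longrightarrow> y1 = -K \<and> 0 \<le> y3"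
    "n = -K \<Longrightarrow> y2 = -K \<and> y3 = 1 \<and> e = 1" "n = -K \<Longrightarrow> w < q \<Longrightarrow> y1 = K"
    using n e y by auto
qed

text \<open>The new coordinate carries the largest weight \<open>v3\<close>, so a value of size
  \<open>K\<close> or more must be offset by extreme old coordinates. The equation for
  \<open>n\<close>, with \<open>a <= b\<close> and \<open>k <= b\<close>, then removes most of the
  sign patterns that the inequalities allow.\<close>

lemma new_coordinate_JP:
  fixes v1 v2 v3 K y1 y2 y3 a b k n :: int
  assumes v: "0 < v1" "0 < v2" "v1 < v3" "v2 < v3" and K: "1 \<le> K"
    and y: "\<bar>y1\<bar> \<le> K" "\<bar>y2\<bar> \<le> K" "\<bar>y3\<bar> \<le> K"
    and ab: "0 \<le> a" "a \<le> b" "1 \<le> b" "0 \<le> k" "k \<le> b"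
    and n: "n = y1 + a * y2 + b * y3 - k"
    and lo: "0 \<le> y2 * v1 + y3 * v2 + n * v3"
    and hi: "y2 * v1 + y3 * v2 + n * v3 < v3"
  shows "\<bar>n\<bar> \<le> K" "n = K \<Longrightarrow> y2 = -K \<and> 0 \<le> y3 \<or> y1 = K \<and> y2 = K \<and> y3 = -K"
    "n = -K \<Longrightarrow> y1 = -K \<and> y2 = K \<and> y3 = 1"
proof -
  have mono: "s * r \<le> t * r" if "s \<le> t" "0 \<le> r" for s t r :: int
    using that by (rule mult_right_mono)
  have monol: "r * s \<le> r * t" if "s \<le> t" "0 \<le> r" for s t r :: int
    using that by (rule mult_left_mono)
  have large: "\<not> K < n \<and> (n = K \<longrightarrow> y2 = -K \<and> 0 \<le> y3 \<or> y1 = K \<and> y2 = K \<and> y3 = -K)"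
  proof (cases "K \<le> n")
    case True
    then have nK: "K * v3 \<le> n * v3" using v by (intro mono) auto
    have step: "s = -K \<and> n = K" if "\<bar>s\<bar> \<le> K" "0 < r" "r < v3" "s * r + n * v3 < v3" for s r
    proof -
      have "n = K"
      proof (rule ccontr)
        assume "n \<noteq> K"
        then have "(K + 1) * v3 \<le> n * v3" using True v by (intro mono) auto
        moreover have "-K * r \<le> s * r" "K * r \<le> K * v3"
          using mono [of "-K" s r] monol [of r v3 K] that K by auto
        ultimately show False using that(4) unfolding ring_distribs by linarith
      qed
      moreover have "s = -K"
      proof (rule ccontr)
        assume "s \<noteq> -K"
        then have "(1 - K) * r \<le> s * r" using that by (intro mono) auto
        moreover have "(K - 1) * r \<le> (K - 1) * v3" using that K by (intro monol) auto
        ultimately show False using that(4) nK unfolding ring_distribs by linarith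
      qed
      ultimately show ?thesis by simp
    qed
    \<comment> \<open>Case 1 violates \<open>hi\<close>. In cases 2 and 4 the only negative
      coordinate must be \<open>-K\<close> by \<open>step\<close>; in case 4 the equation for
      \<open>n\<close> then holds only with \<open>y1 = y2 = K\<close>. In case 3 the equation gives
      \<open>n < K\<close>.\<close>
    consider "0 \<le> y3" "0 \<le> y2" | "0 \<le> y3" "y2 < 0" | "y3 < 0" "y2 \<le> 0" | "y3 < 0" "0 < y2"
      by linarith
    then show ?thesis
    proof cases
      case 1
      then have "0 \<le> y2 * v1" "0 \<le> y3 * v2" "1 * v3 \<le> K * v3"
        using v K mono [of 1 K v3] by auto
      then show ?thesis using nK hi by linarith
    next
      case 2
      then have "y2 * v1 + n * v3 < v3" using v hi mult_nonneg_nonneg [of y3 v2] by linarith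
      then show ?thesis using step [of y2 v1] y v 2 by auto
    next
      case 3
      then have "a * y2 \<le> 0" "b * y3 \<le> b * -1"
        using ab mult_nonneg_nonpos [of a y2] monol [of y3 "-1" b] by auto
      then show ?thesis using n ab y True by auto
    next
      case 4
      then have "y3 * v2 + n * v3 < v3" using v hi mult_nonneg_nonneg [of y2 v1] by linarith
      then have y3: "y3 = -K" "n = K" using step [of y3 v2] y v by auto
      have "a * y2 \<le> b * y2" using ab 4 by (intro mono) auto
      moreover have "b * y2 \<le> b * K" using ab y by (intro monol) auto
      moreover have "K + k + b * K = y1 + a * y2" using n y3 by simp
      ultimately have "b * K \<le> b * y2" "y1 = K" using ab y by linarith+
      then have "y2 = K" using ab y by auto
      then show ?thesis using \<open>y1 = K\<close> y3 by auto
    qed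
  qed auto
  \<comment> \<open>Neither \<open>y2 * v1\<close> nor \<open>y3 * v2\<close> alone offsets
    \<open>K * v3\<close>, so both coordinates are positive. Then \<open>b * y3 - k >= 0\<close> and
    the equation gives \<open>n >= y1 >= -K\<close>; equality fixes \<open>y1\<close> and
    \<open>y3\<close>, and \<open>lo\<close> fixes \<open>y2\<close>.\<close>
  have small: "\<not> n < -K \<and> (n = -K \<longrightarrow> y1 = -K \<and> y2 = K \<and> y3 = 1)"
  proof (cases "n \<le> -K")
    case True
    then have nK: "n * v3 \<le> -K * v3" using v by (intro mono) auto
    have bounds: "y2 * v1 \<le> K * v1" "y3 * v2 \<le> K * v2" "K * v1 < K * v3" "K * v2 < K * v3"
      using v y K by auto
    have "0 < y2"
    proof (rule ccontr)
      assume "\<not> 0 < y2"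
      then have "y2 * v1 \<le> 0" using v by (simp add: mult_nonpos_nonneg)
      then show False using lo nK bounds by linarith
    qed
    moreover have "0 < y3"
    proof (rule ccontr)
      assume "\<not> 0 < y3"
      then have "y3 * v2 \<le> 0" using v by (simp add: mult_nonpos_nonneg)
      then show False using lo nK bounds by linarith
    qed
    ultimately have pos: "1 \<le> y2" "1 \<le> y3" by auto
    have *: "0 \<le> a * y2" "b * 1 \<le> b * y3" using pos ab monol [of 1 y3 b] by auto
    have "y3 = 1"
    proof (rule ccontr)
      assume "y3 \<noteq> 1"
      then have "b * 2 \<le> b * y3" using pos ab by (intro monol) auto
      then show False using * n True ab y by linarith
    qed
    moreover have "n = -K" "y1 = -K" using * n True ab y by linarith+
    moreover have "y2 = K"
    proof (rule ccontr)
      assume "y2 \<noteq> K"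
      then have "y2 * v1 \<le> (K - 1) * v1" using v y by (intro mono) auto
      moreover have "(K - 1) * v1 \<le> (K - 1) * v3" using v K by (intro monol) auto
      ultimately show False using lo nK v \<open>y3 = 1\<close> unfolding ring_distribs by simp
    qed
    ultimately show ?thesis by auto
  qed auto
  show "\<bar>n\<bar> \<le> K" "n = K \<Longrightarrow> y2 = -K \<and> 0 \<le> y3 \<or> y1 = K \<and> y2 = K \<and> y3 = -K"
    "n = -K \<Longrightarrow> y1 = -K \<and> y2 = K \<and> y3 = 1"
    using large small by auto
qed

text \<open>A substitute for \<open>new_coordinate_JP\<close> at norm 1 when the second weight may
  be the largest, whence the maximum in the upper bound. Each of the nine choices of
  \<open>y2\<close>, \<open>y3\<close> is settled by the weight inequalities or by the equation for
  \<open>n\<close>.\<close>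

lemma new_coordinate_JP_1:
  fixes v1 v2 v3 y1 y2 y3 a b k n :: int
  assumes v: "0 < v1" "0 < v2" "v1 < v3" "v1 + v2 \<le> 2 * v3"
    and y: "\<bar>y1\<bar> \<le> 1" "\<bar>y2\<bar> \<le> 1" "\<bar>y3\<bar> \<le> 1"
    and ab: "0 \<le> a" "a \<le> b" "1 \<le> b" "0 \<le> k" "k \<le> b"
    and n: "n = y1 + a * y2 + b * y3 - k"
    and lo: "0 \<le> y2 * v1 + y3 * v2 + n * v3"
    and hi: "y2 * v1 + y3 * v2 + n * v3 < max v2 v3"
  shows "\<bar>n\<bar> \<le> 1"
proof -
  have y': "y2 = -1 \<or> y2 = 0 \<or> y2 = 1" "y3 = -1 \<or> y3 = 0 \<or> y3 = 1" using y by auto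
  have "\<not> 2 \<le> n"
  proof
    assume n2: "2 \<le> n"
    then have "2 * v3 \<le> n * v3" using v by (intro mult_right_mono) auto
    then have "y2 * v1 + y3 * v2 + 2 * v3 < max v2 v3" using hi by linarith
    then show False using y' v n y ab n2 by (elim disjE) auto
  qed
  moreover have "\<not> n \<le> -2"
  proof
    assume n2: "n \<le> -2"
    then have "n * v3 \<le> -2 * v3" using v by (intro mult_right_mono) auto
    then have "0 \<le> y2 * v1 + y3 * v2 - 2 * v3" using lo by linarith
    then show False using y' v n y ab n2 by (elim disjE) auto
  qed
  ultimately show ?thesis by auto
qed

lemma sup_bounded_3: "sup_bounded K (x, i) \<longleftrightarrow> \<bar>x $ 1\<bar> \<le> K \<and> \<bar>x $ 2\<bar> \<le> K \<and> \<bar>x $ 3\<bar> \<le> K"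
  by (simp add: sup_bounded_def forall_3)

lemma sup_bounded_mono: "sup_bounded K f \<Longrightarrow> K \<le> L \<Longrightarrow> sup_bounded L f"
  by (auto simp: sup_bounded_def intro: order_trans)

lemma sup_bounded_less:
  assumes "sup_bounded K f" "\<forall>c. fst f $ c \<noteq> K \<and> fst f $ c \<noteq> - K"
  shows "sup_bounded (K - 1) f"
  unfolding sup_bounded_def
proof
  fix c
  have "\<bar>fst f $ c\<bar> \<le> K" "fst f $ c \<noteq> K" "fst f $ c \<noteq> - K"
    using assms by (auto simp: sup_bounded_def)
  then show "\<bar>fst f $ c\<bar> \<le> K - 1" by linarith
qed

section \<open>Brun: steps that keep the sup norm\<close>

definition increasing :: "int ^ 3 \<Rightarrow> bool" where
  "increasing v \<longleftrightarrow> 0 < v $ 1 \<and> v $ 1 < v $ 2 \<and> v $ 2 < v $ 3"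

lemma increasing_pos: "increasing v \<Longrightarrow> 0 < v $ i"
  using exhaust_3 [of i] by (auto simp: increasing_def)

lemma increasing_push_Br: "increasing v \<Longrightarrow> increasing (push (subst_Br c) v)"
  using exhaust_3 [of c] by (auto simp: increasing_def push_Br)

definition step_Br :: "int \<Rightarrow> 3 \<Rightarrow> face \<Rightarrow> face \<Rightarrow> bool" where
  "step_Br K c = (\<lambda>(y, j) (x, i). move_Br c (y, j) (x, i) \<and> sup_bounded K (y, j) \<and> sup_bounded K (x, i) \<and>
     (let n = x $ (if c = 1 then 2 else 3) in
       (n = K \<longrightarrow> y $ 1 = -K \<and> 0 \<le> y $ 3) \<and>
       (n = -K \<longrightarrow> y $ 2 = -K \<and> y $ 3 = 1 \<and> j = 3 \<and> (c \<noteq> 1 \<longrightarrow> y $ 1 = K))))"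

text \<open>In \<open>new_coordinate_Br\<close> the weights \<open>p\<close>, \<open>q\<close>,
  \<open>w\<close> have indices 1, 2, 3 for the letter 1, then 1, 3, 2 for the letter 2, and 2, 3, 1
  for the letter 3; always \<open>p < q\<close>.\<close>

lemma step_Br_if_move:
  assumes v: "increasing v" and g: "g \<in> plane v" and m: "move_Br c f g"
    and f: "sup_bounded K f" and K: "1 \<le> K"
  shows "step_Br K c f g"
proof -
  obtain x i y j where fg: "f = (y, j)" "g = (x, i)" by force
  obtain e where x: "x = (if c = 1 then vector [y $ 1, y $ 2 + y $ 3 - e, y $ 3]
       else if c = 2 then vector [y $ 1, y $ 3, y $ 2 + y $ 3 - e]
       else vector [y $ 3, y $ 1, y $ 2 + y $ 3 - e])"
    and t: "(c, j, e, i) \<in> {(1, 1, 0, 1), (1, 2, 0, 2), (1, 3, 1, 3), (1, 3, 0, 2),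
       (2, 1, 0, 1), (2, 2, 0, 3), (2, 3, 1, 2), (2, 3, 0, 3),
       (3, 1, 0, 2), (3, 2, 0, 3), (3, 3, 1, 1), (3, 3, 0, 3)}"
    using m unfolding fg move_Br_def case_prod_conv by (elim exE conjE) (rule that)
  have e: "e = 0 \<or> e = 1" "e = 1 \<longrightarrow> j = 3" using t by auto
  have y: "\<bar>y $ 1\<bar> \<le> K" "\<bar>y $ 2\<bar> \<le> K" "\<bar>y $ 3\<bar> \<le> K" using f by (auto simp: fg sup_bounded_3)
  have v': "0 < v $ 1" "v $ 1 < v $ 2" "v $ 2 < v $ 3" "0 < v $ 2" "0 < v $ 3" "v $ 1 < v $ 3"
    using v by (auto simp: increasing_def)
  have gp: "0 \<le> dot x v" "dot x v < v $ i" using g by (auto simp: fg)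
  define n where "n = y $ 2 + y $ 3 - e"
  have "c = 1 \<or> c = 2 \<or> c = 3" by (rule exhaust_3)
  then show ?thesis
  proof (elim disjE)
    assume c: "c = 1"
    have range: "0 \<le> y $ 1 * v $ 1 + y $ 3 * v $ 3 + n * v $ 2"
      "y $ 1 * v $ 1 + y $ 3 * v $ 3 + n * v $ 2 < (if e = 0 then v $ 2 else v $ 3)"
      using gp t v' by (auto simp: c x dot_3 n_def)
    have core: "\<bar>n\<bar> \<le> K" "n = K \<longrightarrow> y $ 1 = -K \<and> 0 \<le> y $ 3"
      "n = -K \<longrightarrow> y $ 2 = -K \<and> y $ 3 = 1 \<and> e = 1" "n = -K \<longrightarrow> v $ 3 < v $ 2 \<longrightarrow> y $ 1 = K"
      using new_coordinate_Br [OF v'(1,2,5) K y e(1) n_def range] by blast+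
    have "x = vector [y $ 1, n, y $ 3]" by (simp add: c x n_def)
    then show ?thesis
      using m f y core e(2) v' unfolding step_Br_def fg c by (simp add: sup_bounded_3 Let_def)
  next
    assume c: "c = 2"
    have range: "0 \<le> y $ 1 * v $ 1 + y $ 3 * v $ 2 + n * v $ 3"
      "y $ 1 * v $ 1 + y $ 3 * v $ 2 + n * v $ 3 < (if e = 0 then v $ 3 else v $ 2)"
      using gp t v' by (auto simp: c x dot_3 n_def)
    have core: "\<bar>n\<bar> \<le> K" "n = K \<longrightarrow> y $ 1 = -K \<and> 0 \<le> y $ 3"
      "n = -K \<longrightarrow> y $ 2 = -K \<and> y $ 3 = 1 \<and> e = 1" "n = -K \<longrightarrow> v $ 2 < v $ 3 \<longrightarrow> y $ 1 = K"
      using new_coordinate_Br [OF v'(1,6,4) K y e(1) n_def range] by blast+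
    have "x = vector [y $ 1, y $ 3, n]" by (simp add: c x n_def)
    then show ?thesis
      using m f y core e(2) v' unfolding step_Br_def fg c by (simp add: sup_bounded_3 Let_def)
  next
    assume c: "c = 3"
    have range: "0 \<le> y $ 1 * v $ 2 + y $ 3 * v $ 1 + n * v $ 3"
      "y $ 1 * v $ 2 + y $ 3 * v $ 1 + n * v $ 3 < (if e = 0 then v $ 3 else v $ 1)"
      using gp t v' by (auto simp: c x dot_3 n_def)
    have core: "\<bar>n\<bar> \<le> K" "n = K \<longrightarrow> y $ 1 = -K \<and> 0 \<le> y $ 3"
      "n = -K \<longrightarrow> y $ 2 = -K \<and> y $ 3 = 1 \<and> e = 1" "n = -K \<longrightarrow> v $ 1 < v $ 3 \<longrightarrow> y $ 1 = K"
      using new_coordinate_Br [OF v'(4,3,1) K y e(1) n_def range] by blast+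
    have "x = vector [y $ 3, y $ 1, n]" by (simp add: c x n_def)
    then show ?thesis
      using m f y core e(2) v' unfolding step_Br_def fg c by (simp add: sup_bounded_3 Let_def)
  qed
qed

text \<open>Properties acquired one after the other, with each letter 3, by the ancestors of a face as
  long as their sup norm remains \<open>K\<close>. A new coordinate \<open>-K\<close> requires an old one, and a new
  coordinate \<open>K\<close> requires a coordinate \<open>-K\<close>; so first \<open>-K\<close> and then \<open>K\<close> dies out.\<close>

definition phase_Br :: "int \<Rightarrow> nat \<Rightarrow> face \<Rightarrow> bool" where
  "phase_Br K m = (\<lambda>(x, i).
     (1 \<le> m \<longrightarrow> \<not> (x $ 1 = -K \<and> x $ 3 = K \<and> x $ 2 \<le> 1 - K)) \<and>
     (2 \<le> m \<longrightarrow> \<not> (x $ 1 = K \<and> x $ 2 = -K \<and> x $ 3 = 1 \<and> i = 3)) \<and>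
     (3 \<le> m \<longrightarrow> x $ 3 \<noteq> -K) \<and> (4 \<le> m \<longrightarrow> x $ 1 \<noteq> -K) \<and> (5 \<le> m \<longrightarrow> x $ 2 \<noteq> -K) \<and>
     (6 \<le> m \<longrightarrow> x $ 3 \<noteq> K) \<and> (7 \<le> m \<longrightarrow> x $ 1 \<noteq> K) \<and> (8 \<le> m \<longrightarrow> x $ 2 \<noteq> K))"

text \<open>The letter 3 turns the coordinates into \<open>(y3, y1, n)\<close>, so excluding a value
  from position 3 excludes it from position 1 and then 2 at the next letters 3. The letters 1 and 2
  preserve every property already acquired.\<close>

lemma phase_Br_step:
  assumes step: "step_Br K c f g" and ph: "phase_Br K m f" and K: "2 \<le> K"
  shows "phase_Br K (if c = 3 then Suc m else m) g"
proof -
  obtain x i y j where fg: "f = (y, j)" "g = (x, i)" by force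
  obtain e where x: "x = (if c = 1 then vector [y $ 1, y $ 2 + y $ 3 - e, y $ 3]
       else if c = 2 then vector [y $ 1, y $ 3, y $ 2 + y $ 3 - e]
       else vector [y $ 3, y $ 1, y $ 2 + y $ 3 - e])"
    and t: "(c, j, e, i) \<in> {(1, 1, 0, 1), (1, 2, 0, 2), (1, 3, 1, 3), (1, 3, 0, 2),
       (2, 1, 0, 1), (2, 2, 0, 3), (2, 3, 1, 2), (2, 3, 0, 3),
       (3, 1, 0, 2), (3, 2, 0, 3), (3, 3, 1, 1), (3, 3, 0, 3)}"
    using step unfolding fg step_Br_def move_Br_def case_prod_conv by (elim exE conjE) (rule that)
  have e: "0 \<le> e" "e \<le> 1" "c = 3 \<longrightarrow> i = 3 \<longrightarrow> e = 0" using t by auto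
  define n where "n = y $ 2 + y $ 3 - e"
  have y: "\<bar>y $ 1\<bar> \<le> K" "\<bar>y $ 2\<bar> \<le> K" "\<bar>y $ 3\<bar> \<le> K"
    using step by (auto simp: step_Br_def fg sup_bounded_3)
  have n: "n = K \<longrightarrow> y $ 1 = -K \<and> 0 \<le> y $ 3"
    "n = -K \<longrightarrow> y $ 2 = -K \<and> y $ 3 = 1 \<and> j = 3 \<and> (c \<noteq> 1 \<longrightarrow> y $ 1 = K)"
    using step exhaust_3 [of c] by (auto simp: step_Br_def fg x n_def Let_def)
  note ph' = ph [unfolded phase_Br_def fg case_prod_conv]
  have phs: "1 \<le> m \<Longrightarrow> \<not> (y $ 1 = -K \<and> y $ 3 = K \<and> y $ 2 \<le> 1 - K)"
    "3 \<le> m \<Longrightarrow> y $ 3 \<noteq> -K" "4 \<le> m \<Longrightarrow> y $ 1 \<noteq> -K" "6 \<le> m \<Longrightarrow> y $ 3 \<noteq> K"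
    "7 \<le> m \<Longrightarrow> y $ 1 \<noteq> K"
    using ph' by blast+
  show ?thesis
  proof (cases "c = 3")
    case True
    then have x': "x $ 1 = y $ 3" "x $ 2 = y $ 1" "x $ 3 = n" by (simp_all add: x n_def)
    have a1: "\<not> (y $ 3 = - K \<and> n = K \<and> y $ 1 \<le> 1 - K)"
      using n(1) K by linarith
    \<comment> \<open>Type 3 after the letter 3 means an empty suffix, so \<open>y2 = 1 - K\<close>:
      the configuration excluded in phase 1.\<close>
    have a2: "\<not> (y $ 3 = K \<and> y $ 1 = - K \<and> n = 1 \<and> i = 3)" if "2 \<le> Suc m"
    proof
      assume *: "y $ 3 = K \<and> y $ 1 = - K \<and> n = 1 \<and> i = 3"
      then have "y $ 2 \<le> 1 - K" using e(3) True n_def by simp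
      moreover have "1 \<le> m" using that by simp
      ultimately show False using phs(1) * by blast
    qed
    have a3: "n \<noteq> - K" if "3 \<le> Suc m"
    proof
      assume "n = - K"
      then have "y $ 1 = K" "y $ 2 = - K" "y $ 3 = 1" "j = 3" using True n(2) by auto
      moreover have "2 \<le> m" using that by simp
      ultimately show False using ph' by blast
    qed
    have a4: "y $ 3 \<noteq> - K" if "4 \<le> Suc m" using that by (intro phs) simp
    have a5: "y $ 1 \<noteq> - K" if "5 \<le> Suc m" using that by (intro phs) simp
    have a6: "n \<noteq> K" if "6 \<le> Suc m" using that n(1) phs(3) by linarith
    have a7: "y $ 3 \<noteq> K" if "7 \<le> Suc m" using that by (intro phs) simp
    have a8: "y $ 1 \<noteq> K" if "8 \<le> Suc m" using that by (intro phs) simp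
    show ?thesis
      unfolding phase_Br_def fg case_prod_conv x' if_P [OF True]
      by (intro conjI impI a1; (rule a2 a3 a4 a5 a6 a7 a8, assumption))
  next
    case False
    then consider (1) "c = 1" | (2) "c = 2" using exhaust_3 [of c] by auto
    then show ?thesis
    proof cases
      case 1
      then have x': "x $ 1 = y $ 1" "x $ 2 = n" "x $ 3 = y $ 3" by (simp_all add: x n_def)
      have "\<not> (y $ 1 = - K \<and> y $ 3 = K \<and> n \<le> 1 - K)" if "1 \<le> m"
      proof
        assume *: "y $ 1 = - K \<and> y $ 3 = K \<and> n \<le> 1 - K"
        then have "y $ 2 \<le> 1 - K" using e n_def K by linarith
        then show False using phs(1) [OF that] * by blast
      qed
      moreover have "y $ 1 \<noteq> - K" if "8 \<le> m"
        using that by (intro phs) simp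
      ultimately show ?thesis
        unfolding phase_Br_def fg case_prod_conv x' if_not_P [OF False]
        using n ph' by blast
    next
      case 2
      then have x': "x $ 1 = y $ 1" "x $ 2 = y $ 3" "x $ 3 = n" by (simp_all add: x n_def)
      have a1: "\<not> (y $ 3 = -K \<and> n = 1)" using y e n_def by linarith
      \<comment> \<open>Here \<open>K >= 2\<close> matters: it makes \<open>1 - K\<close> negative,
        whereas \<open>n = K\<close> requires \<open>y3 >= 0\<close>.\<close>
      have a2: "\<not> (n = K \<and> y $ 3 \<le> 1 - K)" using n(1) K by linarith
      have a3: "n \<noteq> - K" if "3 \<le> m"
      proof
        assume "n = - K"
        then have "y $ 1 = K" "y $ 2 = - K" "y $ 3 = 1" "j = 3" using 2 n(2) by auto
        moreover have "2 \<le> m" using that by simp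
        ultimately show False using ph' by blast
      qed
      have a4: "y $ 3 \<noteq> -K" if "5 \<le> m" using that by (intro phs) simp
      have a5: "n \<noteq> K" if "6 \<le> m" using that n(1) phs(3) by linarith
      have a6: "y $ 3 \<noteq> K" if "8 \<le> m" using that by (intro phs) simp
      show ?thesis
        unfolding phase_Br_def fg case_prod_conv x' if_not_P [OF False]
        by (intro conjI impI; (rule a3 a4 a5 a6 phs, assumption | use a1 a2 in blast))
    qed
  qed
qed

lemma sup_bounded_if_phase_Br:
  assumes "sup_bounded K f" "phase_Br K 8 f"
  shows "sup_bounded (K - 1) f"
  using assms by (intro sup_bounded_less) (auto simp: phase_Br_def forall_3 split: prod.splits)

section \<open>Jacobi-Perron: steps that keep the sup norm\<close>

definition step_JP :: "int \<Rightarrow> face \<Rightarrow> face \<Rightarrow> bool" where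
  "step_JP K = (\<lambda>(y, j) (x, i). sup_bounded K (y, j) \<and> sup_bounded K (x, i) \<and>
     x $ 1 = y $ 2 \<and> x $ 2 = y $ 3 \<and>
     (x $ 3 = K \<longrightarrow> y $ 2 = -K \<and> 0 \<le> y $ 3 \<or> y $ 1 = K \<and> y $ 2 = K \<and> y $ 3 = -K) \<and>
     (x $ 3 = -K \<longrightarrow> y $ 1 = -K \<and> y $ 2 = K \<and> y $ 3 = 1))"

lemma step_JP_if_move:
  assumes v: "0 < v $ 1" "0 < v $ 2" "v $ 1 < v $ 3" "v $ 2 < v $ 3" and g: "g \<in> plane v"
    and m: "move_JP a b f g" and ab: "a \<le> b" "b \<noteq> 0" and f: "sup_bounded K f" and K: "1 \<le> K"
  shows "step_JP K f g"
proof -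
  obtain x i y j where fg: "f = (y, j)" "g = (x, i)" by force
  obtain k :: nat where k: "k \<le> b"
    and x: "x = vector [y $ 2, y $ 3, y $ 1 + int a * y $ 2 + int b * y $ 3 - int k]"
    using m ab unfolding fg move_JP_def case_prod_conv by (elim exE conjE) (rule that [rotated], assumption, linarith)
  have "v $ i \<le> v $ 3" using v exhaust_3 [of i] by auto
  then have gp: "0 \<le> dot x v" "dot x v < v $ 3" using g by (auto simp: fg)
  have y: "\<bar>y $ 1\<bar> \<le> K" "\<bar>y $ 2\<bar> \<le> K" "\<bar>y $ 3\<bar> \<le> K" using f by (auto simp: fg sup_bounded_3)
  define n where "n = y $ 1 + int a * y $ 2 + int b * y $ 3 - int k"
  have x': "x $ 1 = y $ 2" "x $ 2 = y $ 3" "x $ 3 = n" by (simp_all add: x n_def)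
  have ab': "0 \<le> int a" "int a \<le> int b" "1 \<le> int b" "0 \<le> int k" "int k \<le> int b"
    using ab k by simp_all
  have range: "0 \<le> y $ 2 * v $ 1 + y $ 3 * v $ 2 + n * v $ 3"
    "y $ 2 * v $ 1 + y $ 3 * v $ 2 + n * v $ 3 < v $ 3"
    using gp by (simp_all add: dot_3 x')
  have "\<bar>n\<bar> \<le> K" "n = K \<longrightarrow> y $ 2 = -K \<and> 0 \<le> y $ 3 \<or> y $ 1 = K \<and> y $ 2 = K \<and> y $ 3 = -K"
    "n = -K \<longrightarrow> y $ 1 = -K \<and> y $ 2 = K \<and> y $ 3 = 1"
    using new_coordinate_JP [OF v K y ab' n_def range] by blast+
  then show ?thesis
    using f y unfolding step_JP_def fg case_prod_conv sup_bounded_3 x' by blast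
qed

text \<open>Each step shifts \<open>(y1, y2, y3)\<close> to \<open>(y2, y3, n)\<close>. The first
  three clauses successively exclude the configurations that could produce a new \<open>-K\<close>.
  Then \<open>-K\<close> leaves positions 3, 2, 1 in turn, and \<open>K\<close>, which can only
  arise next to \<open>-K\<close>, follows.\<close>

definition phase_JP :: "int \<Rightarrow> nat \<Rightarrow> face \<Rightarrow> bool" where
  "phase_JP K m = (\<lambda>(x, i).
     (1 \<le> m \<longrightarrow> \<not> (x $ 1 = K \<and> x $ 2 = K \<and> x $ 3 = -K)) \<and>
     (2 \<le> m \<longrightarrow> \<not> (x $ 2 = -K \<and> x $ 3 = K)) \<and>
     (3 \<le> m \<longrightarrow> \<not> (x $ 1 = -K \<and> x $ 2 = K \<and> x $ 3 = 1)) \<and>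
     (4 \<le> m \<longrightarrow> x $ 3 \<noteq> -K) \<and> (5 \<le> m \<longrightarrow> x $ 2 \<noteq> -K) \<and> (6 \<le> m \<longrightarrow> x $ 1 \<noteq> -K) \<and>
     (6 \<le> m \<longrightarrow> x $ 3 \<noteq> K) \<and> (7 \<le> m \<longrightarrow> x $ 2 \<noteq> K) \<and> (8 \<le> m \<longrightarrow> x $ 1 \<noteq> K))"

lemma phase_JP_step:
  assumes step: "step_JP K f g" and ph: "phase_JP K m f" and K: "2 \<le> K"
  shows "phase_JP K (Suc m) g"
proof -
  obtain x i y j where fg: "f = (y, j)" "g = (x, i)" by force
  define n where "n = x $ 3"
  have x: "x $ 1 = y $ 2" "x $ 2 = y $ 3" "x $ 3 = n"
    and n: "n = K \<Longrightarrow> y $ 2 = -K \<and> 0 \<le> y $ 3 \<or> y $ 1 = K \<and> y $ 2 = K \<and> y $ 3 = -K"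
      "n = -K \<Longrightarrow> y $ 1 = -K \<and> y $ 2 = K \<and> y $ 3 = 1"
    using step by (simp_all add: step_JP_def fg n_def)
  note ph' = ph [unfolded phase_JP_def fg case_prod_conv]
  have a1: "\<not> (y $ 2 = K \<and> y $ 3 = K \<and> n = -K)"
    using n(2) K by linarith
  have a2: "\<not> (y $ 3 = -K \<and> n = K)" if "2 \<le> Suc m"
  proof
    assume *: "y $ 3 = -K \<and> n = K"
    then have "y $ 1 = K \<and> y $ 2 = K" using n(1) K by linarith
    moreover have "1 \<le> m" using that by simp
    ultimately show False using ph' * by blast
  qed
  have a3: "\<not> (y $ 2 = -K \<and> y $ 3 = K \<and> n = 1)" if "3 \<le> Suc m"
  proof -
    have "2 \<le> m" using that by simp
    then show ?thesis using ph' by blast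
  qed
  have a4: "n \<noteq> -K" if "4 \<le> Suc m"
  proof -
    have "3 \<le> m" using that by simp
    then show ?thesis using ph' n(2) by blast
  qed
  have a5: "y $ 3 \<noteq> -K" if "5 \<le> Suc m"
  proof -
    have "4 \<le> m" using that by simp
    then show ?thesis using ph' by blast
  qed
  have a6: "y $ 2 \<noteq> -K" if "6 \<le> Suc m"
  proof -
    have "5 \<le> m" using that by simp
    then show ?thesis using ph' by blast
  qed
  have a7: "n \<noteq> K" if "6 \<le> Suc m"
    using n(1) a5 a6 that by auto
  have a8: "y $ 3 \<noteq> K" if "7 \<le> Suc m"
  proof -
    have "6 \<le> m" using that by simp
    then show ?thesis using ph' by blast
  qed
  have a9: "y $ 2 \<noteq> K" if "8 \<le> Suc m"
  proof -
    have "7 \<le> m" using that by simp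
    then show ?thesis using ph' by blast
  qed
  show ?thesis
    unfolding phase_JP_def fg case_prod_conv x
    by (intro conjI impI a1; (rule a2 a3 a4 a5 a6 a7 a8 a9, assumption))
qed

lemma sup_bounded_if_phase_JP:
  assumes "sup_bounded K f" "phase_JP K 8 f"
  shows "sup_bounded (K - 1) f"
  using assms by (intro sup_bounded_less) (auto simp: phase_JP_def forall_3 split: prod.splits)

lemma sup_bounded_1_if_move_JP:
  assumes v: "0 < v $ 1" "0 < v $ 2" "v $ 1 < v $ 3" "v $ 1 + v $ 2 \<le> 2 * v $ 3" and g: "g \<in> plane v"
    and m: "move_JP a b f g" and ab: "a \<le> b" "b \<noteq> 0" and f: "sup_bounded 1 f"
  shows "sup_bounded 1 g"
proof -
  obtain x i y j where fg: "f = (y, j)" "g = (x, i)" by force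
  obtain k :: nat where k: "k \<le> b"
    and x: "x = vector [y $ 2, y $ 3, y $ 1 + int a * y $ 2 + int b * y $ 3 - int k]"
    using m ab unfolding fg move_JP_def case_prod_conv by (elim exE conjE) (rule that [rotated], assumption, linarith)
  have "v $ i \<le> max (v $ 2) (v $ 3)" using v exhaust_3 [of i] by auto
  then have gp: "0 \<le> dot x v" "dot x v < max (v $ 2) (v $ 3)" using g by (auto simp: fg)
  have y: "\<bar>y $ 1\<bar> \<le> 1" "\<bar>y $ 2\<bar> \<le> 1" "\<bar>y $ 3\<bar> \<le> 1" using f by (auto simp: fg sup_bounded_3)
  define n where "n = y $ 1 + int a * y $ 2 + int b * y $ 3 - int k"
  have x': "x $ 1 = y $ 2" "x $ 2 = y $ 3" "x $ 3 = n" by (simp_all add: x n_def)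
  have ab': "0 \<le> int a" "int a \<le> int b" "1 \<le> int b" "0 \<le> int k" "int k \<le> int b"
    using ab k by simp_all
  have range: "0 \<le> y $ 2 * v $ 1 + y $ 3 * v $ 2 + n * v $ 3"
    "y $ 2 * v $ 1 + y $ 3 * v $ 2 + n * v $ 3 < max (v $ 2) (v $ 3)"
    using gp by (simp_all add: dot_3 x')
  show ?thesis
    using new_coordinate_JP_1 [OF v y ab' n_def range] y unfolding fg sup_bounded_3 x' by blast
qed

section \<open>Descent to the seed\<close>

lemma plane_foldr:
  assumes inv: "\<And>c. invertible (incidence_matrix (\<tau> c))" and ne: "\<And>c j. \<tau> c j \<noteq> []"
    and V: "finite V" "unit_pattern \<subseteq> V" "V \<subseteq> plane v" and pos: "\<And>i. 0 < v $ i"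
  shows "finite (foldr (\<lambda>c. dual_subst (\<tau> c)) cs V) \<and>
    unit_pattern \<subseteq> foldr (\<lambda>c. dual_subst (\<tau> c)) cs V \<and>
    foldr (\<lambda>c. dual_subst (\<tau> c)) cs V \<subseteq> plane (foldr (\<lambda>c. push (\<tau> c)) cs v) \<and>
    (\<forall>i. 0 < foldr (\<lambda>c. push (\<tau> c)) cs v $ i)"
proof (induction cs)
  case (Cons c cs)
  have "0 < (\<Sum>i\<leftarrow>w. u $ i)" if "w \<noteq> []" "\<forall>i. 0 < u $ i" for w :: "3 list" and u :: "int ^ 3"
    using that by (induction w rule: list_nonempty_induct) (auto simp: add_pos_pos)
  then show ?case
    using Cons ne finite_dual_subst unit_pattern_subset_dual_subst dual_subst_plane [OF inv]
    by (simp add: push_nth)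
qed (use V pos in simp)

lemma rad_foldr_ge:
  assumes inv: "\<And>c. invertible (incidence_matrix (\<tau> c))" and ne: "\<And>c j. \<tau> c j \<noteq> []"
    and V: "finite V" "unit_pattern \<subseteq> V" "V \<subseteq> plane v" and pos: "\<And>i. 0 < v $ i"
    and ball: "\<And>f. f \<in> plane (foldr (\<lambda>c. push (\<tau> c)) cs v) \<Longrightarrow> sup_bounded (int R) f \<Longrightarrow>
      f \<in> foldr (\<lambda>c. dual_subst (\<tau> c)) cs V"
  shows "R \<le> rad (foldr (\<lambda>c. dual_subst (\<tau> c)) cs V)"
  using plane_foldr [of \<tau>, OF inv ne V pos, of cs] ball by (intro rad_ge) auto

lemma dual_substI: "f \<in> dual_face \<sigma> g \<Longrightarrow> g \<in> P \<Longrightarrow> f \<in> dual_subst \<sigma> P"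
  by (auto simp: dual_subst_def)

section \<open>Brun: descent through a product of substitutions\<close>

abbreviation weights_Br :: "3 list \<Rightarrow> int ^ 3 \<Rightarrow> int ^ 3" where
  "weights_Br \<equiv> foldr (\<lambda>c. push (subst_Br c))"

abbreviation pattern_Br :: "3 list \<Rightarrow> pattern \<Rightarrow> pattern" where
  "pattern_Br \<equiv> foldr (\<lambda>c. dual_subst (subst_Br c))"

lemma increasing_weights_Br: "increasing v \<Longrightarrow> increasing (weights_Br cs v)"
  by (induction cs) (simp_all add: increasing_push_Br)

text \<open>The head of \<open>cs\<close> is the outermost substitution, the first one that a
  descent undoes. Quantifying over all \<open>cs\<close> lets the notion apply to the remaining
  tail; \<open>T\<close> counts only letters 3, the ones that advance the phase.\<close>

definition captured_Br :: "int ^ 3 \<Rightarrow> pattern \<Rightarrow> nat \<Rightarrow> (face \<Rightarrow> bool) \<Rightarrow> bool" where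
  "captured_Br v V T J \<longleftrightarrow> (\<forall>cs f. T \<le> count_list cs 3 \<longrightarrow> f \<in> plane (weights_Br cs v) \<longrightarrow> J f \<longrightarrow>
     f \<in> pattern_Br cs V)"

lemma captured_Br_0:
  assumes v: "increasing v" and V: "\<And>f. f \<in> plane v \<Longrightarrow> J f \<Longrightarrow> f \<in> V"
    and step: "\<And>c w f g. increasing w \<Longrightarrow> g \<in> plane w \<Longrightarrow> move_Br c f g \<Longrightarrow> J f \<Longrightarrow> J g"
  shows "captured_Br v V 0 J"
proof -
  have "f \<in> pattern_Br cs V" if "f \<in> plane (weights_Br cs v)" "J f" for cs f
    using that
  proof (induction cs arbitrary: f)
    case (Cons c cs)
    then have "f \<in> plane (push (subst_Br c) (weights_Br cs v))" by simp
    then obtain g where g: "g \<in> plane (weights_Br cs v)" "f \<in> dual_face (subst_Br c) g"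
      "move_Br c f g"
      by (rule ancestor_Br)
    then have "J g" using step increasing_weights_Br [OF v] Cons.prems by blast
    then show ?case using Cons.IH [OF g(1)] dual_substI [OF g(2)] by simp
  qed (simp add: V)
  then show ?thesis by (simp add: captured_Br_def)
qed

lemma captured_Br_mono:
  "captured_Br v V T J \<Longrightarrow> T \<le> T' \<Longrightarrow> (\<And>f. J' f \<Longrightarrow> J f) \<Longrightarrow> captured_Br v V T' J'"
  unfolding captured_Br_def by (meson order_trans)

text \<open>Letters other than 3 are undone with \<open>J\<close> preserved, until the first letter
  3 hands over to \<open>J'\<close> and the smaller threshold.\<close>

lemma captured_Br_Suc:
  assumes v: "increasing v" and cap: "captured_Br v V T J'"
    and step: "\<And>c w f g. increasing w \<Longrightarrow> g \<in> plane w \<Longrightarrow> move_Br c f g \<Longrightarrow> J f \<Longrightarrow>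
      (if c = 3 then J' g else J g)"
  shows "captured_Br v V (Suc T) J"
proof -
  have "f \<in> pattern_Br cs V" if "Suc T \<le> count_list cs 3" "f \<in> plane (weights_Br cs v)" "J f" for cs f
    using that
  proof (induction cs arbitrary: f)
    case (Cons c cs)
    then have "f \<in> plane (push (subst_Br c) (weights_Br cs v))" by simp
    then obtain g where g: "g \<in> plane (weights_Br cs v)" "f \<in> dual_face (subst_Br c) g"
      "move_Br c f g"
      by (rule ancestor_Br)
    then have J: "if c = 3 then J' g else J g"
      using step increasing_weights_Br [OF v] Cons.prems by blast
    have "g \<in> pattern_Br cs V"
    proof (cases "c = 3")
      case True
      then have "T \<le> count_list cs 3" "J' g" using J Cons.prems(1) by simp_all
      then show ?thesis using cap g(1) unfolding captured_Br_def by blast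
    next
      case False
      then show ?thesis using J g(1) Cons.prems(1) by (intro Cons.IH) auto
    qed
    then show ?case using dual_substI [OF g(2)] by simp
  qed simp
  then show ?thesis by (simp add: captured_Br_def)
qed

text \<open>The induction runs backwards through the phases: phase 8 means norm
  \<open>K - 1\<close>, already captured, and each phase less costs one more letter 3. Phase 0
  imposes nothing beyond the norm \<open>K\<close>.\<close>

lemma captured_Br_phase:
  assumes v: "increasing v" and K: "2 \<le> K" and cap: "captured_Br v V T (sup_bounded (K - 1))" and "m \<le> 8"
  shows "captured_Br v V (T + m) (\<lambda>f. sup_bounded K f \<and> phase_Br K (8 - m) f)"
  using \<open>m \<le> 8\<close>
proof (induction m)
  case 0
  show ?case
    by (rule captured_Br_mono [OF cap]) (auto intro: sup_bounded_if_phase_Br)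
next
  case (Suc m)
  then have IH: "captured_Br v V (T + m) (\<lambda>f. sup_bounded K f \<and> phase_Br K (8 - m) f)" by simp
  have m: "Suc (8 - Suc m) = 8 - m" using Suc.prems by simp
  have "captured_Br v V (Suc (T + m)) (\<lambda>f. sup_bounded K f \<and> phase_Br K (8 - Suc m) f)"
  proof (rule captured_Br_Suc [OF v IH])
    fix c w f g
    assume "increasing w" "g \<in> plane w" "move_Br c f g"
      and f: "sup_bounded K f \<and> phase_Br K (8 - Suc m) f"
    then have step: "step_Br K c f g" using K by (intro step_Br_if_move) auto
    then have "sup_bounded K g" by (auto simp: step_Br_def)
    then show "if c = 3 then sup_bounded K g \<and> phase_Br K (8 - m) g
        else sup_bounded K g \<and> phase_Br K (8 - Suc m) g"
      using phase_Br_step [OF step conjunct2 [OF f] K] unfolding m by (cases "c = 3") simp_all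
  qed
  then show ?case by simp
qed

lemma captured_Br_bounded:
  assumes v: "increasing v" and cap: "captured_Br v V T (sup_bounded 1)"
  shows "captured_Br v V (T + 8 * n) (sup_bounded (int n + 1))"
proof (induction n)
  case (Suc n)
  have "captured_Br v V (T + 8 * n + 8) (\<lambda>f. sup_bounded (int n + 2) f \<and> phase_Br (int n + 2) (8 - 8) f)"
    by (rule captured_Br_phase [OF v]) (use Suc in \<open>simp_all add: add.commute\<close>)
  then show ?case
    by (rule captured_Br_mono) (auto simp: phase_Br_def algebra_simps)
qed (use cap in simp)

section \<open>Jacobi-Perron: descent through an admissible expansion\<close>

abbreviation weights_JP :: "(nat \<times> nat) list \<Rightarrow> int ^ 3 \<Rightarrow> int ^ 3" where
  "weights_JP \<equiv> foldr (\<lambda>c. push (subst_JP (fst c) (snd c)))"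

abbreviation pattern_JP :: "(nat \<times> nat) list \<Rightarrow> pattern \<Rightarrow> pattern" where
  "pattern_JP \<equiv> foldr (\<lambda>c. dual_subst (subst_JP (fst c) (snd c)))"

lemma admissible_JP_Cons:
  "admissible_JP (p # ps) \<longleftrightarrow> fst p \<le> snd p \<and> snd p \<noteq> 0 \<and> admissible_JP ps \<and>
     (ps \<noteq> [] \<longrightarrow> fst p = snd p \<longrightarrow> fst (hd ps) \<noteq> 0)"
  (is "?L \<longleftrightarrow> ?R")
proof
  assume L: ?L
  then have "ps \<noteq> [] \<longrightarrow> fst p = snd p \<longrightarrow> fst (hd ps) \<noteq> 0"
    by (auto simp: admissible_JP_def hd_conv_nth dest: spec [of _ 0])
  moreover have "fst (ps ! (k + 1)) \<noteq> 0"
    if "k + 1 < length ps" "fst (ps ! k) = snd (ps ! k)" for k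
    using L that unfolding admissible_JP_def by (auto dest: spec [of _ "Suc k"])
  ultimately show ?R
    using L by (auto simp: admissible_JP_def)
next
  assume R: ?R
  have "fst ((p # ps) ! (k + 1)) \<noteq> 0"
    if "k + 1 < length (p # ps)" "fst ((p # ps) ! k) = snd ((p # ps) ! k)" for k
    using R that by (cases k) (auto simp: admissible_JP_def hd_conv_nth)
  then show ?L
    using R by (auto simp: admissible_JP_def)
qed

lemma pos_push_JP:
  assumes "\<forall>i. 0 < v $ i"
  shows "\<forall>i. 0 < push (subst_JP a b) v $ i"
  using assms by (auto simp: push_JP forall_3 intro!: add_pos_nonneg)

lemma push_JP_less:
  assumes "\<forall>i. 0 < v $ i" "b \<noteq> 0"
  shows "push (subst_JP a b) v $ 1 < push (subst_JP a b) v $ 3"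
    "a \<noteq> 0 \<Longrightarrow> push (subst_JP a b) v $ 1 < push (subst_JP a b) v $ 2"
proof -
  have *: "1 * v $ 3 \<le> int n * v $ 3" if "n \<noteq> 0" for n
    using assms that by (intro mult_right_mono) (auto simp: less_imp_le)
  show "push (subst_JP a b) v $ 1 < push (subst_JP a b) v $ 3"
    "a \<noteq> 0 \<Longrightarrow> push (subst_JP a b) v $ 1 < push (subst_JP a b) v $ 2"
    using assms(1) * [OF assms(2)] * [of a] by (simp_all add: push_JP add_pos_nonneg add_strict_increasing)
qed

lemma pos_weights_JP: "\<forall>i. 0 < v $ i \<Longrightarrow> \<forall>i. 0 < weights_JP ps v $ i"
  by (induction ps) (simp_all add: pos_push_JP)

text \<open>For the outer pair \<open>(a, b)\<close> and inner weights \<open>u\<close>, the second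
  inequality reads \<open>u1 + a * u3 < u2 + b * u3\<close>. If \<open>a < b\<close> it follows from
  \<open>u1 < u3\<close>; if \<open>a = b\<close>, admissibility makes the next first entry nonzero,
  so \<open>u1 < u2\<close>. These facts on \<open>u\<close> come from one more push, hence length
  2.\<close>

lemma weights_JP_less:
  assumes v: "\<forall>i. 0 < v $ i" and ps: "admissible_JP ps" "2 \<le> length ps"
  shows "weights_JP ps v $ 1 < weights_JP ps v $ 3" "weights_JP ps v $ 2 < weights_JP ps v $ 3"
proof -
  obtain p q qs where psq: "ps = p # q # qs"
    using ps(2) by (metis Suc_le_length_iff numeral_2_eq_2)
  define w where "w = weights_JP qs v"
  define u where "u = push (subst_JP (fst q) (snd q)) w"
  have pos: "\<forall>i. 0 < w $ i" "\<forall>i. 0 < u $ i"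
    using v by (simp_all add: w_def u_def pos_weights_JP pos_push_JP)
  have adm: "fst p \<le> snd p" "snd p \<noteq> 0" "snd q \<noteq> 0" "fst p = snd p \<Longrightarrow> fst q \<noteq> 0"
    using ps(1) by (auto simp: psq admissible_JP_Cons)
  have eq: "weights_JP ps v = push (subst_JP (fst p) (snd p)) u"
    by (simp add: psq w_def u_def)
  show "weights_JP ps v $ 1 < weights_JP ps v $ 3"
    unfolding eq by (rule push_JP_less) (use pos adm in auto)
  have u: "u $ 1 < u $ 3" "fst q \<noteq> 0 \<Longrightarrow> u $ 1 < u $ 2"
    unfolding u_def by (rule push_JP_less; use pos adm in auto)+
  have "u $ 1 + int (fst p) * u $ 3 < u $ 2 + int (snd p) * u $ 3"
  proof (cases "fst p = snd p")
    case True
    then show ?thesis using u(2) adm(4) by simp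
  next
    case False
    then have "int (fst p) + 1 \<le> int (snd p)" using adm(1) by simp
    then have "(int (fst p) + 1) * u $ 3 \<le> int (snd p) * u $ 3"
      using pos(2) by (intro mult_right_mono) (auto simp: less_imp_le)
    moreover have "0 < u $ 2" using pos(2) by blast
    ultimately show ?thesis using u(1) unfolding ring_distribs by linarith
  qed
  then show "weights_JP ps v $ 2 < weights_JP ps v $ 3"
    by (simp add: eq push_JP)
qed

definition captured_JP :: "int ^ 3 \<Rightarrow> pattern \<Rightarrow> nat \<Rightarrow> (face \<Rightarrow> bool) \<Rightarrow> bool" where
  "captured_JP v V T J \<longleftrightarrow> (\<forall>ps f. admissible_JP ps \<longrightarrow> T \<le> length ps \<longrightarrow>
     f \<in> plane (weights_JP ps v) \<longrightarrow> J f \<longrightarrow> f \<in> pattern_JP ps V)"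

lemma JP_descend:
  assumes v: "\<forall>i. 0 < v $ i" and ps: "admissible_JP (p # ps)" "2 \<le> length ps"
    and f: "f \<in> plane (weights_JP (p # ps) v)" "sup_bounded K f" and K: "1 \<le> K"
  obtains g where "g \<in> plane (weights_JP ps v)" "f \<in> dual_face (subst_JP (fst p) (snd p)) g"
    "step_JP K f g"
proof -
  have "f \<in> plane (push (subst_JP (fst p) (snd p)) (weights_JP ps v))" using f(1) by simp
  then obtain g where g: "g \<in> plane (weights_JP ps v)"
    "f \<in> dual_face (subst_JP (fst p) (snd p)) g" "move_JP (fst p) (snd p) f g"
    by (rule ancestor_JP)
  have adm: "admissible_JP ps" "fst p \<le> snd p" "snd p \<noteq> 0"
    using ps(1) by (auto simp: admissible_JP_Cons)
  have "step_JP K f g"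
    using pos_weights_JP [OF v] weights_JP_less [OF v adm(1) ps(2)] g adm f(2) K
    by (intro step_JP_if_move [of "weights_JP ps v"]) auto
  then show thesis using that g by blast
qed

lemma captured_JP_mono:
  "captured_JP v V T J \<Longrightarrow> T \<le> T' \<Longrightarrow> (\<And>f. J' f \<Longrightarrow> J f) \<Longrightarrow> captured_JP v V T' J'"
  unfolding captured_JP_def by (meson order_trans)

lemma captured_JP_Suc:
  assumes v: "\<forall>i. 0 < v $ i" and cap: "captured_JP v V T J'" and "2 \<le> T" and K: "1 \<le> K"
    and J: "\<And>f. J f \<Longrightarrow> sup_bounded K f"
    and step: "\<And>f g. step_JP K f g \<Longrightarrow> J f \<Longrightarrow> J' g"
  shows "captured_JP v V (Suc T) J"
  unfolding captured_JP_def
proof (intro allI impI)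
  fix ps f assume ps: "admissible_JP ps" "Suc T \<le> length ps" and f: "f \<in> plane (weights_JP ps v)" "J f"
  then obtain p qs where psq: "ps = p # qs" by (cases ps) auto
  obtain g where g: "g \<in> plane (weights_JP qs v)" "f \<in> dual_face (subst_JP (fst p) (snd p)) g"
    "step_JP K f g"
    by (rule JP_descend [OF v, of p qs f K]) (use ps f J K \<open>2 \<le> T\<close> psq in auto)
  have "g \<in> pattern_JP qs V"
    using cap g(1) step [OF g(3) f(2)] ps
    unfolding captured_JP_def psq admissible_JP_Cons list.size add_Suc_right add_0_right Suc_le_mono
    by blast
  then show "f \<in> pattern_JP ps V" using dual_substI [OF g(2)] by (simp add: psq)
qed

lemma captured_JP_phase:
  assumes v: "\<forall>i. 0 < v $ i" and K: "2 \<le> K" and cap: "captured_JP v V T (sup_bounded (K - 1))"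
    and "2 \<le> T" "m \<le> 8"
  shows "captured_JP v V (T + m) (\<lambda>f. sup_bounded K f \<and> phase_JP K (8 - m) f)"
  using \<open>m \<le> 8\<close>
proof (induction m)
  case 0
  show ?case
    by (rule captured_JP_mono [OF cap]) (auto intro: sup_bounded_if_phase_JP)
next
  case (Suc m)
  then have IH: "captured_JP v V (T + m) (\<lambda>f. sup_bounded K f \<and> phase_JP K (8 - m) f)" by simp
  have m: "Suc (8 - Suc m) = 8 - m" using Suc.prems by simp
  have "captured_JP v V (Suc (T + m)) (\<lambda>f. sup_bounded K f \<and> phase_JP K (8 - Suc m) f)"
  proof (rule captured_JP_Suc [OF v IH, of K])
    fix f g
    assume step: "step_JP K f g" and f: "sup_bounded K f \<and> phase_JP K (8 - Suc m) f"
    have "sup_bounded K g" using step by (auto simp: step_JP_def)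
    then show "sup_bounded K g \<and> phase_JP K (8 - m) g"
      using phase_JP_step [OF step conjunct2 [OF f] K] by (simp only: m)
  qed (use K \<open>2 \<le> T\<close> in auto)
  then show ?case by simp
qed

lemma captured_JP_bounded:
  assumes v: "\<forall>i. 0 < v $ i" and cap: "captured_JP v V 2 (sup_bounded 1)"
  shows "captured_JP v V (2 + 8 * n) (sup_bounded (int n + 1))"
proof (induction n)
  case (Suc n)
  have "captured_JP v V (2 + 8 * n + 8) (\<lambda>f. sup_bounded (int n + 2) f \<and> phase_JP (int n + 2) (8 - 8) f)"
    by (rule captured_JP_phase [OF v]) (use Suc in \<open>simp_all add: add.commute\<close>)
  then show ?case
    by (rule captured_JP_mono) (auto simp: phase_JP_def algebra_simps)
qed (use cap in simp)

text \<open>The last two steps are treated apart: if the sequence ends with a pair \<open>(a, a)\<close>, then the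
  third weight may fail to be the largest one in the plane of the last but one ancestor.\<close>

lemma captured_JP_2:
  assumes v: "\<forall>i. 0 < v $ i" "v $ 1 < v $ 3" "v $ 1 + v $ 2 \<le> 2 * v $ 3" "v $ 1 \<le> 2 * v $ 2"
    and seed: "\<And>a b c d f g h. admissible_JP [(c, d), (a, b)] \<Longrightarrow> sup_bounded 1 f \<Longrightarrow> sup_bounded 1 g \<Longrightarrow>
      sup_bounded 1 h \<Longrightarrow> move_JP c d f g \<Longrightarrow> move_JP a b g h \<Longrightarrow> h \<in> plane v \<Longrightarrow> h \<in> V"
  shows "captured_JP v V 2 (sup_bounded 1)"
proof -
  have "f \<in> pattern_JP ps V" if "admissible_JP ps" "2 \<le> length ps" "f \<in> plane (weights_JP ps v)"
    "sup_bounded 1 f" for ps f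
    using that
  proof (induction ps arbitrary: f)
    case (Cons p ps)
    have p: "fst p \<le> snd p" "snd p \<noteq> 0" "admissible_JP ps"
      using Cons.prems(1) by (auto simp: admissible_JP_Cons)
    show ?case
    proof (cases "2 \<le> length ps")
      case True
      obtain g where g: "g \<in> plane (weights_JP ps v)" "f \<in> dual_face (subst_JP (fst p) (snd p)) g"
        "step_JP 1 f g"
        by (rule JP_descend [OF v(1) Cons.prems(1) True Cons.prems(3,4)]) simp
      then have "sup_bounded 1 g" by (auto simp: step_JP_def)
      then show ?thesis using Cons.IH [OF p(3) True g(1)] dual_substI [OF g(2)] by simp
    next
      case False
      then obtain q where ps: "ps = [q]"
        using Cons.prems(2) by (cases ps) (auto simp: Suc_le_eq)
      have q: "fst q \<le> snd q" "snd q \<noteq> 0" using p(3) by (auto simp: ps admissible_JP_Cons)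
      define u where "u = push (subst_JP (fst q) (snd q)) v"
      obtain g where g: "g \<in> plane u" "f \<in> dual_face (subst_JP (fst p) (snd p)) g"
        "move_JP (fst p) (snd p) f g"
        by (rule ancestor_JP [of f "fst p" "snd p" u]) (use Cons.prems(3) in \<open>simp add: ps u_def\<close>)
      obtain h where h: "h \<in> plane v" "g \<in> dual_face (subst_JP (fst q) (snd q)) h"
        "move_JP (fst q) (snd q) g h"
        by (rule ancestor_JP [of g "fst q" "snd q" v]) (use g(1) in \<open>simp add: u_def\<close>)
      have u: "\<forall>i. 0 < u $ i" "u $ 1 < u $ 3"
        unfolding u_def by (rule pos_push_JP [OF v(1)]) (rule push_JP_less [OF v(1) q(2)])
      \<comment> \<open>Here \<open>u = (v3, v1 + a * v3, v2 + b * v3)\<close> with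
        \<open>a <= b\<close> and \<open>1 <= b\<close>, so the claim reduces to
        \<open>v1 <= 2 * v2\<close>.\<close>
      have u3: "u $ 1 + u $ 2 \<le> 2 * u $ 3"
      proof -
        have "int (fst q) * v $ 3 \<le> int (snd q) * v $ 3" "1 * v $ 3 \<le> int (snd q) * v $ 3"
          using q v(1) by (auto intro!: mult_right_mono simp: less_imp_le)
        then show ?thesis using v(4) by (simp add: u_def push_JP)
      qed
      have bg: "sup_bounded 1 g"
        using sup_bounded_1_if_move_JP [OF spec [OF u(1)] spec [OF u(1)] u(2) u3 g(1,3) p(1,2) Cons.prems(4)] .
      have "sup_bounded 1 h"
        using sup_bounded_1_if_move_JP [OF spec [OF v(1)] spec [OF v(1)] v(2,3) h(1,3) q bg] .
      moreover have "admissible_JP [(fst p, snd p), (fst q, snd q)]"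
        using Cons.prems(1) by (simp add: ps)
      ultimately have "h \<in> V" using seed Cons.prems(4) bg g(3) h by blast
      then show ?thesis
        using dual_substI [OF g(2) dual_substI [OF h(2)]] by (simp add: ps)
    qed
  qed simp
  then show ?thesis by (simp add: captured_JP_def)
qed

section \<open>The seeds\<close>

lemmas seed_simps = unit_pattern_def seed_C_def seed_C'_def seed_D_def seed_E_def

lemma sup_bounded_1_cases:
  assumes "sup_bounded 1 (x, i)"
  obtains "x $ 1 = -1 \<or> x $ 1 = 0 \<or> x $ 1 = 1" "x $ 2 = -1 \<or> x $ 2 = 0 \<or> x $ 2 = 1"
    "x $ 3 = -1 \<or> x $ 3 = 0 \<or> x $ 3 = 1" "i = 1 \<or> i = 2 \<or> i = 3"
proof
  show "x $ 1 = -1 \<or> x $ 1 = 0 \<or> x $ 1 = 1" "x $ 2 = -1 \<or> x $ 2 = 0 \<or> x $ 2 = 1"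
    "x $ 3 = -1 \<or> x $ 3 = 0 \<or> x $ 3 = 1"
    using assms unfolding sup_bounded_3 by linarith+
qed (rule exhaust_3)

text \<open>A finite check over 27 vectors and three types. With \<open>V_subset_plane\<close> it
  identifies the seed with the part of norm at most 1 of the plane. Seeds 3 and 4 mirror seeds 1 and
  2 by exchanging the first two coordinates, whence their weights.\<close>

lemma plane_V1:
  assumes "sup_bounded 1 (x, i)" "(x, i) \<in> plane (vector [1, 2, 5])"
  shows "(x, i) \<in> V1_JP"
  using assms(1)
proof (rule sup_bounded_1_cases)
qed (use assms(2) in \<open>unfold in_plane dot_3, elim disjE; simp add: V1_JP_def seed_simps; simp add: vec_eq_3\<close>)

lemma plane_V3:
  assumes "sup_bounded 1 (x, i)" "(x, i) \<in> plane (vector [2, 1, 5])"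
  shows "(x, i) \<in> V3_JP"
  using assms(1)
proof (rule sup_bounded_1_cases)
qed (use assms(2) in \<open>unfold in_plane dot_3, elim disjE; simp add: V3_JP_def seed_simps; simp add: vec_eq_3\<close>)

lemma plane_V2:
  assumes "sup_bounded 1 (x, i)" "(x, i) \<in> plane (vector [2, 4, 5])"
  shows "(x, i) \<in> V2_JP \<or> (x, i) = (vector [0, -1, 1], 2) \<or> (x, i) = (vector [1, -1, 1], 2)"
  using assms(1)
proof (rule sup_bounded_1_cases)
qed (use assms(2) in \<open>unfold in_plane dot_3, elim disjE; simp add: V2_JP_def seed_simps; simp add: vec_eq_3\<close>)

lemma plane_V4:
  assumes "sup_bounded 1 (x, i)" "(x, i) \<in> plane (vector [4, 2, 5])"
  shows "(x, i) \<in> V4_JP \<or> (x, i) = (vector [-1, 0, 1], 1) \<or> (x, i) = (vector [-1, 1, 1], 1)"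
  using assms(1)
proof (rule sup_bounded_1_cases)
qed (use assms(2) in \<open>unfold in_plane dot_3, elim disjE; simp add: V4_JP_def seed_simps; simp add: vec_eq_3\<close>)

lemma V_subset_plane:
  "V1_JP \<subseteq> plane (vector [1, 2, 5])" "V2_Br \<subseteq> plane (vector [2, 4, 5])"
  "V2_JP \<subseteq> plane (vector [2, 4, 5])"
  "V3_JP \<subseteq> plane (vector [2, 1, 5])" "V4_JP \<subseteq> plane (vector [4, 2, 5])"
  by (simp_all add: dot_3 V1_JP_def V2_Br_def V2_JP_def V3_JP_def V4_JP_def seed_simps)

lemma V_finite: "finite V1_JP" "finite V2_Br" "finite V2_JP" "finite V3_JP" "finite V4_JP"
  by (simp_all add: V1_JP_def V2_Br_def V2_JP_def V3_JP_def V4_JP_def seed_simps)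

lemma V_unit: "unit_pattern \<subseteq> V1_JP" "unit_pattern \<subseteq> V2_Br" "unit_pattern \<subseteq> V2_JP"
  "unit_pattern \<subseteq> V3_JP" "unit_pattern \<subseteq> V4_JP"
  by (auto simp: V1_JP_def V2_Br_def V2_JP_def V3_JP_def V4_JP_def)

text \<open>Covers both faces that \<open>V2_JP\<close> lacks. An ancestor of type 2 has
  \<open>k = b\<close>, so its last coordinate is \<open>y1 + a * y2 - 2 * b <= 1 - b\<close>, which
  cannot be 1.\<close>

lemma no_move_JP_to_V2_gap:
  assumes "move_JP a b (y, j) (x, 2)" "sup_bounded 1 (y, j)" "a \<le> b" "b \<noteq> 0"
  shows "\<not> (x $ 2 = -1 \<and> x $ 3 = 1)"
proof
  assume x: "x $ 2 = -1 \<and> x $ 3 = 1"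
  then have "y $ 3 = -1" "y $ 1 + int a * y $ 2 + int b * y $ 3 - int b = 1"
    using assms(1) by (auto simp: move_JP_def)
  moreover have "y $ 1 \<le> 1" "int a * y $ 2 \<le> int a * 1"
    using assms(2) mult_left_mono [of "y $ 2" 1 "int a"] by (auto simp: sup_bounded_3)
  ultimately show False using assms(3,4) by simp
qed

text \<open>Covers both faces that \<open>V4_JP\<close> lacks; here two moves are followed. The type
  1 forces \<open>j = 2\<close>, and then the earlier move gives \<open>y3 <= 1 + c - 2 * d\<close>,
  so \<open>c = d\<close> and \<open>y3 = 0\<close>. Admissibility yields \<open>a >= 1\<close>,
  against \<open>y1 - 2 * a = 1\<close>.\<close>

lemma no_moves_JP_to_V4_gap:
  assumes "admissible_JP [(c, d), (a, b)]" "move_JP c d (z, k) (y, j)" "move_JP a b (y, j) (x, 1)"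
    and sup_bounded: "sup_bounded 1 (z, k)" "sup_bounded 1 (y, j)"
  shows "\<not> (x $ 1 = -1 \<and> (x $ 2 = 0 \<or> x $ 2 = 1) \<and> x $ 3 = 1)"
proof
  assume x: "x $ 1 = -1 \<and> (x $ 2 = 0 \<or> x $ 2 = 1) \<and> x $ 3 = 1"
  have adm: "c \<le> d" "d \<noteq> 0" "c = d \<longrightarrow> a \<noteq> 0"
    using assms(1) by (auto simp: admissible_JP_Cons)
  have y: "j = 2" "y $ 2 = -1" "y $ 3 = 0 \<or> y $ 3 = 1"
      "y $ 1 + int a * y $ 2 + int b * y $ 3 - int a = 1"
    using assms(3) x by (auto simp: move_JP_def)
  have z: "z $ 3 = -1" "z $ 1 + int c * y $ 1 + int d * z $ 3 - int d = y $ 3"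
    using assms(2) y(1,2) by (auto simp: move_JP_def)
  have "z $ 1 \<le> 1" "y $ 1 \<le> 1" "int c * y $ 1 \<le> int c * 1"
    using sup_bounded mult_left_mono [of "y $ 1" 1 "int c"] by (auto simp: sup_bounded_3)
  then have "y $ 3 = 0" "c = d" using y(3) z adm by auto
  then show False using y(2,4) adm \<open>y $ 1 \<le> 1\<close> by auto
qed

text \<open>The only face of the ball missing from \<open>V2_Br\<close> is \<open>[(1, -1, 1), 2]\<close>. Its descendants
  of sup norm 1 are obtained by a letter 3, followed by letters different from 3.\<close>

definition gap_V2 :: "face \<Rightarrow> bool" where
  "gap_V2 = (\<lambda>(x, i). i = 2 \<and> x $ 1 = 1 \<and> x $ 2 = -1 \<and> x $ 3 = 1)"

definition pre_gap_V2 :: "face \<Rightarrow> bool" where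
  "pre_gap_V2 = (\<lambda>(x, i). i = 1 \<and> x $ 1 = -1 \<and>
     (x $ 2 = 0 \<and> x $ 3 = 1 \<or> x $ 2 = -1 \<and> x $ 3 = 1 \<or> x $ 2 = 1 \<and> x $ 3 = 0))"

lemma move_Br_gap:
  assumes "step_Br 1 c f g"
  shows "pre_gap_V2 g \<Longrightarrow> c \<noteq> 3 \<and> pre_gap_V2 f" "gap_V2 g \<Longrightarrow> c = 3 \<and> pre_gap_V2 f"
proof -
  obtain x i y j where fg: "f = (y, j)" "g = (x, i)" by force
  obtain e where x: "x = (if c = 1 then vector [y $ 1, y $ 2 + y $ 3 - e, y $ 3]
       else if c = 2 then vector [y $ 1, y $ 3, y $ 2 + y $ 3 - e]
       else vector [y $ 3, y $ 1, y $ 2 + y $ 3 - e])"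
    and t: "(c, j, e, i) \<in> {(1, 1, 0, 1), (1, 2, 0, 2), (1, 3, 1, 3), (1, 3, 0, 2),
       (2, 1, 0, 1), (2, 2, 0, 3), (2, 3, 1, 2), (2, 3, 0, 3),
       (3, 1, 0, 2), (3, 2, 0, 3), (3, 3, 1, 1), (3, 3, 0, 3)}"
    using assms unfolding fg step_Br_def move_Br_def case_prod_conv by (elim exE conjE) (rule that)
  have y: "\<bar>y $ 1\<bar> \<le> 1" "\<bar>y $ 2\<bar> \<le> 1" "\<bar>y $ 3\<bar> \<le> 1"
    using assms by (auto simp: step_Br_def fg sup_bounded_3)
  show "pre_gap_V2 g \<Longrightarrow> c \<noteq> 3 \<and> pre_gap_V2 f" "gap_V2 g \<Longrightarrow> c = 3 \<and> pre_gap_V2 f"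
    using t y unfolding fg x pre_gap_V2_def gap_V2_def by auto
qed

lemma captured_V1_Br: "captured_Br (vector [1, 2, 5]) V1_Br 2 (sup_bounded 1)"
proof -
  have "captured_Br (vector [1, 2, 5]) V1_Br 0 (sup_bounded 1)"
  proof (rule captured_Br_0)
    fix c w f g
    assume "increasing w" "g \<in> plane w" "move_Br c f g" "sup_bounded 1 f"
    then have "step_Br 1 c f g" by (rule step_Br_if_move) simp
    then show "sup_bounded 1 g" by (auto simp: step_Br_def)
  next
    fix f assume "f \<in> plane (vector [1, 2, 5])" "sup_bounded 1 f"
    then show "f \<in> V1_Br"
      using plane_V1 [of "fst f" "snd f"] by (simp add: V1_Br_def V1_JP_def)
  qed (simp add: increasing_def)
  then show ?thesis by (rule captured_Br_mono) auto
qed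

lemma captured_V2_Br: "captured_Br (vector [2, 4, 5]) V2_Br 2 (sup_bounded 1)"
proof -
  have v: "increasing (vector [2, 4, 5])" by (simp add: increasing_def)
  have step: "step_Br 1 c f g" "sup_bounded 1 g"
    if "increasing w" "g \<in> plane w" "move_Br c f g" "sup_bounded 1 f" for c w f g
  proof -
    show "step_Br 1 c f g" using that by (rule step_Br_if_move) simp
    then show "sup_bounded 1 g" by (auto simp: step_Br_def)
  qed
  have "captured_Br (vector [2, 4, 5]) V2_Br 0 (\<lambda>f. sup_bounded 1 f \<and> \<not> pre_gap_V2 f \<and> \<not> gap_V2 f)"
  proof (rule captured_Br_0 [OF v])
    fix f assume f: "f \<in> plane (vector [2, 4, 5])" "sup_bounded 1 f \<and> \<not> pre_gap_V2 f \<and> \<not> gap_V2 f"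
    then have "f \<in> V2_JP \<or> f = (vector [0, -1, 1], 2) \<or> f = (vector [1, -1, 1], 2)"
      using plane_V2 [of "fst f" "snd f"] by simp
    moreover have "f \<noteq> (vector [1, -1, 1], 2)" using f(2) by (auto simp: gap_V2_def)
    ultimately show "f \<in> V2_Br" by (auto simp: V2_Br_def V2_JP_def)
  qed (use step move_Br_gap in blast)
  \<comment> \<open>From outside \<open>pre_gap_V2\<close>, a letter 3 leads outside both
    \<open>pre_gap_V2\<close> and \<open>gap_V2\<close>.\<close>
  then have "captured_Br (vector [2, 4, 5]) V2_Br (Suc 0) (\<lambda>f. sup_bounded 1 f \<and> \<not> pre_gap_V2 f)"
    by (rule captured_Br_Suc [OF v]) (use step move_Br_gap in \<open>simp, blast\<close>)
  \<comment> \<open>From any face of norm at most 1, a letter 3 leads outside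
    \<open>pre_gap_V2\<close>; hence the threshold 2.\<close>
  then have "captured_Br (vector [2, 4, 5]) V2_Br (Suc (Suc 0)) (sup_bounded 1)"
    by (rule captured_Br_Suc [OF v]) (use step move_Br_gap in \<open>simp, blast\<close>)
  then show ?thesis by (simp add: numeral_2_eq_2)
qed

section \<open>From captured faces to the radius\<close>

lemma rad_Br_ge:
  assumes v: "increasing v" and V: "finite V" "unit_pattern \<subseteq> V" "V \<subseteq> plane v"
    and cap: "captured_Br v V 2 (sup_bounded 1)" and R: "2 + 8 * R \<le> count_list cs 3"
  shows "R \<le> rad (foldr Sigma_Br cs V)"
proof -
  have "Sigma_Br = (\<lambda>c. dual_subst (subst_Br c))"
    by (simp add: fun_eq_iff Sigma_Br_def)
  moreover have "captured_Br v V (2 + 8 * R) (sup_bounded (int R + 1))"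
    by (rule captured_Br_bounded [OF v cap])
  then have "f \<in> pattern_Br cs V" if "f \<in> plane (weights_Br cs v)" "sup_bounded (int R) f" for f
    using that R sup_bounded_mono [OF that(2), of "int R + 1"] unfolding captured_Br_def
    by (simp del: split_paired_All)
  then have "R \<le> rad (pattern_Br cs V)"
    using increasing_pos [OF v] invertible_Br V
    by (intro rad_foldr_ge [of subst_Br]) (auto simp: subst_Br_def mk_subst_def)
  ultimately show ?thesis by simp
qed

lemma rad_JP_ge:
  assumes v: "\<forall>i. 0 < v $ i" and V: "finite V" "unit_pattern \<subseteq> V" "V \<subseteq> plane v"
    and cap: "captured_JP v V 2 (sup_bounded 1)" and R: "admissible_JP ps" "2 + 8 * R \<le> length ps"
  shows "R \<le> rad (foldr (\<lambda>(a, b). Sigma_JP a b) ps V)"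
proof -
  have "(\<lambda>(a, b). Sigma_JP a b) = (\<lambda>c. dual_subst (subst_JP (fst c) (snd c)))"
    by (simp add: fun_eq_iff Sigma_JP_def)
  moreover have "captured_JP v V (2 + 8 * R) (sup_bounded (int R + 1))"
    by (rule captured_JP_bounded [OF v cap])
  then have "f \<in> pattern_JP ps V" if "f \<in> plane (weights_JP ps v)" "sup_bounded (int R) f" for f
    using that R sup_bounded_mono [OF that(2), of "int R + 1"] unfolding captured_JP_def
    by (simp del: split_paired_All)
  then have "R \<le> rad (pattern_JP ps V)"
    using v invertible_JP V
    by (intro rad_foldr_ge [of "\<lambda>c. subst_JP (fst c) (snd c)"]) (auto simp: subst_JP_def mk_subst_def)
  ultimately show ?thesis by simp
qed

lemma captured_V_JP:
  "captured_JP (vector [1, 2, 5]) V1_JP 2 (sup_bounded 1)"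
  "captured_JP (vector [2, 4, 5]) V2_JP 2 (sup_bounded 1)"
  "captured_JP (vector [2, 1, 5]) V3_JP 2 (sup_bounded 1)"
  "captured_JP (vector [4, 2, 5]) V4_JP 2 (sup_bounded 1)"
proof -
  show "captured_JP (vector [1, 2, 5]) V1_JP 2 (sup_bounded 1)"
  proof (rule captured_JP_2)
    fix h :: face assume "sup_bounded 1 h" "h \<in> plane (vector [1, 2, 5])"
    then show "h \<in> V1_JP" using plane_V1 [of "fst h" "snd h"] by simp
  qed (simp_all add: forall_3)
  show "captured_JP (vector [2, 1, 5]) V3_JP 2 (sup_bounded 1)"
  proof (rule captured_JP_2)
    fix h :: face assume "sup_bounded 1 h" "h \<in> plane (vector [2, 1, 5])"
    then show "h \<in> V3_JP" using plane_V3 [of "fst h" "snd h"] by simp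
  qed (simp_all add: forall_3)
  show "captured_JP (vector [2, 4, 5]) V2_JP 2 (sup_bounded 1)"
  proof (rule captured_JP_2)
    fix a b c d f g h
    assume adm: "admissible_JP [(c, d), (a, b)]" and g: "sup_bounded 1 g" "move_JP a b g h"
      and h: "sup_bounded 1 h" "h \<in> plane (vector [2, 4, 5])"
    have "\<not> (fst h $ 2 = -1 \<and> fst h $ 3 = 1)" if "snd h = 2"
      using no_move_JP_to_V2_gap [of a b "fst g" "snd g" "fst h"] adm g that
      by (metis admissible_JP_Cons fst_conv prod.collapse snd_conv)
    then have "h \<noteq> (vector [0, -1, 1], 2)" "h \<noteq> (vector [1, -1, 1], 2)" by auto
    then show "h \<in> V2_JP" using plane_V2 [of "fst h" "snd h"] h by simp
  qed (simp_all add: forall_3)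
  show "captured_JP (vector [4, 2, 5]) V4_JP 2 (sup_bounded 1)"
  proof (rule captured_JP_2)
    fix a b c d f g h
    assume adm: "admissible_JP [(c, d), (a, b)]" and f: "sup_bounded 1 f" "move_JP c d f g"
      and g: "sup_bounded 1 g" "move_JP a b g h"
      and h: "sup_bounded 1 h" "h \<in> plane (vector [4, 2, 5])"
    have "\<not> (fst h $ 1 = -1 \<and> (fst h $ 2 = 0 \<or> fst h $ 2 = 1) \<and> fst h $ 3 = 1)" if "snd h = 1"
      using no_moves_JP_to_V4_gap [of c d a b "fst f" "snd f" "fst g" "snd g" "fst h"] adm f g that
      by (metis prod.collapse)
    then have "h \<noteq> (vector [-1, 0, 1], 1)" "h \<noteq> (vector [-1, 1, 1], 1)" by auto
    then show "h \<in> V4_JP" using plane_V4 [of "fst h" "snd h"] h by simp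
  qed (simp_all add: forall_3)
qed

theorem theorem5p1:
  shows "\<forall>R::nat. \<exists>N::nat.
    (\<forall>is. count_list is 3 > N \<longrightarrow>
      (\<forall>V \<in> {V1_Br, V2_Br}. rad (foldr Sigma_Br is V) \<ge> R)) \<and>
    (\<forall>ab. admissible_JP ab \<and> length ab \<ge> N \<longrightarrow>
      (\<forall>V \<in> {V1_JP, V2_JP, V3_JP, V4_JP}. rad (foldr (\<lambda>(a, b). Sigma_JP a b) ab V) \<ge> R))"
proof (intro allI exI conjI impI)
  \<comment> \<open>The bound is \<open>N = 2 + 8 * R\<close>: threshold 2 captures norm 1, and each
    further unit of norm costs 8 letters 3, or 8 pairs in the Jacobi-Perron case.\<close>
  fix R :: nat and cs :: "3 list"
  assume "2 + 8 * R < count_list cs 3"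
  then have cs: "2 + 8 * R \<le> count_list cs 3" by simp
  have "V1_Br = V1_JP" by (simp add: V1_Br_def V1_JP_def)
  then have "R \<le> rad (foldr Sigma_Br cs V1_Br)"
    by (intro rad_Br_ge [OF _ _ _ _ captured_V1_Br cs])
      (simp_all add: increasing_def V_finite V_unit V_subset_plane)
  moreover have "R \<le> rad (foldr Sigma_Br cs V2_Br)"
    by (intro rad_Br_ge [OF _ _ _ _ captured_V2_Br cs])
      (simp_all add: increasing_def V_finite V_unit V_subset_plane)
  ultimately show "\<forall>V \<in> {V1_Br, V2_Br}. rad (foldr Sigma_Br cs V) \<ge> R" by simp
next
  fix R :: nat and ab
  assume ab: "admissible_JP ab \<and> 2 + 8 * R \<le> length ab"
  note rad_ge = rad_JP_ge [OF _ _ _ _ _ conjunct1 [OF ab] conjunct2 [OF ab]]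
  show "\<forall>V \<in> {V1_JP, V2_JP, V3_JP, V4_JP}. rad (foldr (\<lambda>(a, b). Sigma_JP a b) ab V) \<ge> R"
    using rad_ge [OF _ V_finite(1) V_unit(1) V_subset_plane(1) captured_V_JP(1)]
      rad_ge [OF _ V_finite(3) V_unit(3) V_subset_plane(3) captured_V_JP(2)]
      rad_ge [OF _ V_finite(4) V_unit(4) V_subset_plane(4) captured_V_JP(3)]
      rad_ge [OF _ V_finite(5) V_unit(5) V_subset_plane(5) captured_V_JP(4)]
    by (simp add: forall_3)
qed

end
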